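(* Let $\varphi:S^1\to S^1$ be an orientation preserving homeomorphism with irrational rotation number, and let $\mu_\Psi$ be its displacement distribution with respect to its invariant measure $\mu$. For every $\varepsilon>0$ there exists a neighbourhood $\mathcal{U}\subset C^0(S^1)$ of $\varphi$ such that for every orientation preserving homeomorphism $\widetilde\varphi\in\mathcal{U}$ (with rational or irrational rotation number) and every $x_0\in[0,1]$ we have $$d_F\Big(\lim_{n\to\infty}\frac1n\sum_{i=0}^{n-1}\delta_{\widetilde\Psi(\widetilde\Phi^i(x_0))},\ \mu_\Psi\Big)<\varepsilon ,$$ where the limit is the weak limit of probability measures.
   Context: $S^1$ is covered by $\mathbb{R}$ via $x\mapsto\exp(2\pi\mathrm{i}x)$; $C^0(S^1)$ carries the uniform metric. $\Phi$ is the lift of $\varphi$ with $\Phi(0)\in(0,1)$, $\Psi=\Phi-\mathrm{Id}$; $\mu$ is the unique $\varphi$-invariant Borel probability measure, regarded as a measure on $[0,1)$, and $\mu_\Psi(A)=\mu(\{x\in[0,1):\Psi(x)\in A\})$. $\widetilde\Phi$ is the lift of $\widetilde\varphi$ with $\widetilde\Phi(0)\in[0,1)$ and $\widetilde\Psi=\widetilde\Phi-\mathrm{Id}$ is its displacement function. $\delta_y$ is the Dirac measure at $y$. The Fortet–Mourier distance of Borel probability measures $\mu,\nu$ on a compact metric space $X$ (here $X=[0,1]$) is $d_F(\mu,\nu)=\sup\{|\int_X f\,d\mu-\int_X f\,d\nu|:\ f \text{ is 1-Lipschitz}\}$. *)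

theory Defs
  imports "HOL-Probability.Probability"
begin

abbreviation S1 :: "complex set" where
  "S1 \<equiv> sphere 0 1"

definition circle_cover :: "real \<Rightarrow> complex" where
  "circle_cover x = exp (2 * of_real pi * \<i> * of_real x)"

definition is_lift :: "(real \<Rightarrow> real) \<Rightarrow> (complex \<Rightarrow> complex) \<Rightarrow> bool" where
  "is_lift \<Phi> \<phi> \<longleftrightarrow>
     continuous_on UNIV \<Phi> \<and> (\<forall>x. circle_cover (\<Phi> x) = \<phi> (circle_cover x))"

text \<open>Self-maps of the circle are represented by functions that are \<^const>\<open>undefined\<close> outside
  \<^term>\<open>S1\<close>, so that equality of functions is equality of maps on the circle.\<close>

definition orientation_preserving_homeo :: "(complex \<Rightarrow> complex) \<Rightarrow> bool" where
  "orientation_preserving_homeo \<phi> \<longleftrightarrow>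
     \<phi> \<in> extensional S1 \<and> (\<exists>\<psi>. homeomorphism S1 S1 \<phi> \<psi>) \<and>
     (\<exists>\<Phi>. is_lift \<Phi> \<phi> \<and> strict_mono \<Phi>)"

text \<open>Two lifts of the same map differ by an integer constant, so the choice of the lift only
  affects the limit by an integer, which \<^const>\<open>frac\<close> removes. The limit does not depend on the
  base point, here \<open>0\<close>.\<close>

definition rotation_number :: "(complex \<Rightarrow> complex) \<Rightarrow> real" where
  "rotation_number \<phi> = frac (lim (\<lambda>n. ((SOME \<Phi>. is_lift \<Phi> \<phi>) ^^ n) 0 / real n))"

definition displacement :: "(real \<Rightarrow> real) \<Rightarrow> real \<Rightarrow> real" where
  "displacement \<Phi> x = \<Phi> x - x"

definition C0_S1 :: "(complex \<Rightarrow> complex) set" where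
  "C0_S1 = {f \<in> S1 \<rightarrow>\<^sub>E S1. continuous_on S1 f}"

text \<open>The value \<open>0\<close> outside \<^term>\<open>C0_S1\<close> is irrelevant; \<^locale>\<open>Metric_space\<close> asks for a distance
  function that is nonnegative and symmetric on the whole type.\<close>

definition uniform_dist :: "(complex \<Rightarrow> complex) \<Rightarrow> (complex \<Rightarrow> complex) \<Rightarrow> real" where
  "uniform_dist f g =
     (if f \<in> C0_S1 \<and> g \<in> C0_S1 then (SUP z\<in>S1. dist (f z) (g z)) else 0)"

lemma C0_S1_bdd:
  assumes "f \<in> C0_S1" "g \<in> C0_S1"
  shows "bdd_above ((\<lambda>z. dist (f z) (g z)) ` S1)"
proof (rule bdd_aboveI2)
  fix z :: complex assume "z \<in> S1"
  then have "norm (f z) = 1" "norm (g z) = 1"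
    using assms by (auto simp: C0_S1_def PiE_def Pi_def)
  then show "dist (f z) (g z) \<le> 2"
    using norm_triangle_ineq4[of "f z" "g z"] by (simp add: dist_norm)
qed

lemma dist_le_uniform_dist:
  assumes "f \<in> C0_S1" "g \<in> C0_S1" "z \<in> S1"
  shows "dist (f z) (g z) \<le> uniform_dist f g"
  using cSUP_upper[OF assms(3) C0_S1_bdd[OF assms(1,2)]] assms by (simp add: uniform_dist_def)

lemma uniform_dist_le:
  assumes "f \<in> C0_S1" "g \<in> C0_S1" "\<And>z. z \<in> S1 \<Longrightarrow> dist (f z) (g z) \<le> c"
  shows "uniform_dist f g \<le> c"
proof -
  have "S1 \<noteq> {}" by simp
  then show ?thesis
    using assms cSUP_least[of S1 "\<lambda>z. dist (f z) (g z)" c] by (simp add: uniform_dist_def)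
qed

lemma Metric_space_C0_S1: "Metric_space C0_S1 uniform_dist"
proof
  have one: "(1::complex) \<in> S1" by simp
  fix f g :: "complex \<Rightarrow> complex"
  show nn: "0 \<le> uniform_dist f g"
  proof (cases "f \<in> C0_S1 \<and> g \<in> C0_S1")
    case True
    then show ?thesis
      using order_trans[OF zero_le_dist dist_le_uniform_dist[OF _ _ one]] by blast
  next
    case False
    then show ?thesis unfolding uniform_dist_def by (simp only: if_False order_refl)
  qed
  show "uniform_dist f g = uniform_dist g f"
    by (auto simp: uniform_dist_def dist_commute)
  assume f: "f \<in> C0_S1" and g: "g \<in> C0_S1"
  show "uniform_dist f g = 0 \<longleftrightarrow> f = g"
  proof
    assume 0: "uniform_dist f g = 0"
    have "f z = g z" if "z \<in> S1" for z
      using dist_le_uniform_dist[OF f g that] 0 by simp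
    with f g show "f = g"
      by (intro extensionalityI[of f S1]) (auto simp: C0_S1_def PiE_def)
  next
    assume "f = g"
    then have "uniform_dist f g \<le> 0" using f by (intro uniform_dist_le) auto
    with nn show "uniform_dist f g = 0" by simp
  qed
  fix h :: "complex \<Rightarrow> complex" assume h: "h \<in> C0_S1"
  show "uniform_dist f h \<le> uniform_dist f g + uniform_dist g h"
  proof (rule uniform_dist_le[OF f h])
    fix z :: complex assume z: "z \<in> S1"
    show "dist (f z) (h z) \<le> uniform_dist f g + uniform_dist g h"
      using dist_triangle[of "f z" "h z" "g z"]
        dist_le_uniform_dist[OF f g z] dist_le_uniform_dist[OF g h z] by linarith
  qed
qed

abbreviation C0_topology :: "(complex \<Rightarrow> complex) topology" where
  "C0_topology \<equiv> Metric_space.mtopology C0_S1 uniform_dist"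

definition invariant_prob :: "(complex \<Rightarrow> complex) \<Rightarrow> complex measure \<Rightarrow> bool" where
  "invariant_prob \<phi> \<mu> \<longleftrightarrow>
     prob_space \<mu> \<and> sets \<mu> = sets (restrict_space borel S1) \<and>
     (\<forall>A\<in>sets \<mu>. emeasure \<mu> (\<phi> -` A \<inter> space \<mu>) = emeasure \<mu> A)"

text \<open>A measure on the circle, regarded as a measure on \<open>[0,1)\<close> by means of the bijection that
  \<^const>\<open>circle_cover\<close> induces between \<open>[0,1)\<close> and the circle.\<close>

definition on_unit_interval :: "complex measure \<Rightarrow> real measure" where
  "on_unit_interval \<mu> =
     distr \<mu> (restrict_space borel {0..<1}) (inv_into {0..<1} circle_cover)"

definition displacement_distribution :: "(real \<Rightarrow> real) \<Rightarrow> complex measure \<Rightarrow> real measure" where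
  "displacement_distribution \<Psi> \<mu> = distr (on_unit_interval \<mu>) borel \<Psi>"

definition empirical_measure :: "(nat \<Rightarrow> real) \<Rightarrow> nat \<Rightarrow> real measure" where
  "empirical_measure y n =
     measure_of UNIV (sets borel)
       (\<lambda>A. ennreal (1 / real n) * (\<Sum>i<n. emeasure (return borel (y i)) A))"

text \<open>For Borel probability measures concentrated on \<open>X\<close>.\<close>

definition fortet_mourier :: "'a::metric_space set \<Rightarrow> 'a measure \<Rightarrow> 'a measure \<Rightarrow> real" where
  "fortet_mourier X M N =
     (SUP f\<in>{f :: 'a \<Rightarrow> real. 1-lipschitz_on X f}. \<bar>(LINT x:X|M. f x) - (LINT x:X|N. f x)\<bar>)"

lemma inv_circle_cover:
  assumes "z \<in> S1"
  shows "inv_into {0..<1} circle_cover z = Arg2pi z / (2 * pi)"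
proof (rule inv_into_f_eq)
  show "inj_on circle_cover {0..<1}"
  proof
    fix x y :: real
    assume xy: "x \<in> {0..<1}" "y \<in> {0..<1}" and eq: "circle_cover x = circle_cover y"
    have *: "Arg2pi (circle_cover t) = 2 * pi * t" if "t \<in> {0..<1}" for t
      using that by (intro Arg2pi_unique[of 1]) (auto simp: circle_cover_def mult_ac)
    have "2 * pi * x = 2 * pi * y"
      unfolding *[OF xy(1), symmetric] *[OF xy(2), symmetric] eq ..
    then show "x = y" by simp
  qed
  show "Arg2pi z / (2 * pi) \<in> {0..<1}"
    using Arg2pi[of z] by (auto simp: field_simps)
  show "circle_cover (Arg2pi z / (2 * pi)) = z"
    using assms Arg2pi_eq[of z] by (auto simp: circle_cover_def mult_ac)
qed

lemma measurable_inv_circle_cover: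
  "inv_into {0..<1} circle_cover
     \<in> measurable (restrict_space borel S1) (restrict_space borel {0..<1})"
proof (rule measurable_restrict_space2)
  show "inv_into {0..<1} circle_cover \<in> space (restrict_space borel S1) \<rightarrow> {0..<1}"
    using Arg2pi by (auto simp: inv_circle_cover space_restrict_space divide_simps Arg2pi_ge_0)
  have 1: "Arg2pi \<in> borel_measurable (restrict_space borel (- \<real>\<^sub>\<ge>\<^sub>0))"
    by (intro borel_measurable_continuous_on_restrict continuous_at_imp_continuous_on)
      (auto intro: continuous_at_Arg2pi)
  have 2: "Arg2pi \<in> borel_measurable (restrict_space borel \<real>\<^sub>\<ge>\<^sub>0)"
    by (subst measurable_cong[where g = "\<lambda>_. 0"])
      (auto simp: space_restrict_space Arg2pi_eq_0 nonneg_Reals_cmod_eq_Re complex_nonneg_Reals_iff complex_is_Real_iff)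
  have [measurable]: "Arg2pi \<in> borel_measurable borel"
  proof (rule measurable_piecewise_restrict[of "{\<real>\<^sub>\<ge>\<^sub>0, - \<real>\<^sub>\<ge>\<^sub>0}"])
    fix A :: "complex set" assume A: "A \<in> {\<real>\<^sub>\<ge>\<^sub>0, - \<real>\<^sub>\<ge>\<^sub>0}"
    have "\<real>\<^sub>\<ge>\<^sub>0 \<in> sets (borel :: complex measure)"
      by (rule borel_closed[OF closed_nonneg_Reals_complex])
    then show "A \<inter> space borel \<in> sets borel"
      using A by (elim insertE) auto
    show "Arg2pi \<in> borel_measurable (restrict_space borel A)"
      using A 1 2 by blast
  qed auto
  have "(\<lambda>z. Arg2pi z / (2 * pi)) \<in> borel_measurable (restrict_space borel S1)"
    by (intro measurable_restrict_space1) simp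
  then show "inv_into {0..<1} circle_cover \<in> borel_measurable (restrict_space borel S1)"
    by (rule measurable_cong[THEN iffD2, rotated])
      (auto simp: space_restrict_space inv_circle_cover)
qed

lemma emeasure_displacement_distribution:
  assumes "sets \<mu> = sets (restrict_space borel S1)" "\<Psi> \<in> borel_measurable borel" "A \<in> sets borel"
  shows "emeasure (displacement_distribution \<Psi> \<mu>) A =
         emeasure (on_unit_interval \<mu>) {x \<in> {0..<1}. \<Psi> x \<in> A}"
proof -
  have "\<Psi> \<in> measurable (on_unit_interval \<mu>) borel"
    unfolding on_unit_interval_def using measurable_restrict_space1[OF assms(2)] by simp
  moreover have "\<Psi> -` A \<inter> space (on_unit_interval \<mu>) = {x \<in> {0..<1}. \<Psi> x \<in> A}"
    by (auto simp: on_unit_interval_def space_restrict_space)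
  ultimately show ?thesis
    by (simp add: displacement_distribution_def emeasure_distr assms(3))
qed

lemma sets_empirical_measure [simp]: "sets (empirical_measure y n) = sets borel"
  using sets.sigma_sets_eq[of "borel :: real measure"]
  by (simp add: empirical_measure_def)

lemma emeasure_empirical_measure:
  assumes "A \<in> sets borel"
  shows "emeasure (empirical_measure y n) A = ennreal (1 / real n) * (\<Sum>i<n. indicator A (y i))"
proof -
  let ?m = "\<lambda>A. ennreal (1 / real n) * (\<Sum>i<n. emeasure (return borel (y i)) A)"
  have "emeasure (empirical_measure y n) A = ?m A"
    unfolding empirical_measure_def
  proof (rule emeasure_measure_of_sigma)
    show "sigma_algebra UNIV (sets (borel :: real measure))"
      using sets.sigma_algebra_axioms[of "borel :: real measure"] by simp
    show "positive (sets borel) ?m" by (simp add: positive_def)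
    show "countably_additive (sets borel) ?m"
    proof (rule countably_additiveI)
      fix B :: "nat \<Rightarrow> real set"
      assume B: "range B \<subseteq> sets borel" "disjoint_family B" "(\<Union>i. B i) \<in> sets borel"
      have "(\<Sum>j. ?m (B j)) =
          ennreal (1 / real n) * (\<Sum>i<n. \<Sum>j. emeasure (return borel (y i)) (B j))"
        by (simp add: suminf_sum)
      also have "\<dots> = ?m (\<Union>j. B j)"
        using B by (subst suminf_emeasure) auto
      finally show "(\<Sum>j. ?m (B j)) = ?m (\<Union>j. B j)" .
    qed
  qed (fact assms)
  with assms show ?thesis by simp
qed

end

theory Submission
  imports Defs
begin

text \<open>The proof compares orbits over blocks of a fixed length rather than invariant measures.

  \<^bold>\<open>One block suffices for \<open>\<phi>\<close>.\<close> The map \<open>\<phi>\<close> is uniquely ergodic because a monotone map of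
  degree one (\<open>semiconj\<close>) carries its orbits to orbits of an irrational rotation. Being monotone,
  it maps visits to an arc to visits to an arc, so the visiting frequencies converge uniformly in
  the starting point. Approximating observables by step functions on a fine partition gives
  \<open>equiuniform_equidistribution\<close>: a single block length \<open>N\<close> makes the averages over \<open>N\<close> steps
  independent, up to \<open>e\<close>, of the starting point, simultaneously for all observables with a common
  bound and modulus of continuity. The observables \<open>f \<circ> \<Psi>\<close> with \<open>f\<close> 1-Lipschitz and bounded by
  \<open>1\<close> are such a family. Integrating over the invariant measure shows that the common value \<open>c\<close> of
  the block averages is also the integral of \<open>f\<close> against \<open>\<mu>\<^sub>\<Psi>\<close>, up to \<open>e\<close>.

  \<^bold>\<open>Blocks are stable.\<close> If \<open>\<phi>'\<close> is close to \<open>\<phi>\<close>, then their lifts are uniformly close, and so are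
  their first \<open>N\<close> iterates (\<open>iter_stable\<close>). Hence every block of length \<open>N\<close> in an orbit of \<open>\<phi>'\<close>
  has average close to \<open>c\<close>, and then so has the whole orbit (\<open>block_averages\<close>), since it is a
  concatenation of blocks.

  \<^bold>\<open>The weak limit exists.\<close> It is enough that Birkhoff averages of continuous observables converge
  along each orbit of \<open>\<phi>'\<close> (\<open>birkhoff_averages_convergent\<close>), because the empirical measures live on
  \<open>[0,1]\<close> and thus are tight. For an irrational translation number the averages over blocks are
  almost constant, as above. For a translation number \<open>p/q\<close> the map \<open>F\<^sup>q - p\<close> is monotone with
  bounded orbits, so the orbit is asymptotic to a periodic one and blocks of length \<open>q\<close> have
  convergent averages.\<close>

section \<open>Averages over blocks\<close>

text \<open>Cut the first \<open>n\<close> terms into blocks of length \<open>N\<close>: only the first \<open>K\<close> blocks and the incomplete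
  last one are not controlled by \<open>\<eta>\<close>, and together they contribute a constant independent of \<open>n\<close>.\<close>

lemma block_sums_bound:
  fixes u :: "nat \<Rightarrow> real"
  assumes bdd: "\<And>i. \<bar>u i\<bar> \<le> B" and N: "N > 0"
    and blocks: "\<And>k. k \<ge> K \<Longrightarrow> \<bar>(\<Sum>i<N. u (k * N + i)) - real N * c\<bar> \<le> real N * \<eta>"
    and "\<eta> \<ge> 0"
  shows "\<bar>(\<Sum>i<n. u i) - real n * c\<bar> \<le> real n * \<eta> + real ((K + 1) * N) * (B + \<bar>c\<bar>)"
proof -
  define v where "v i = u i - c" for i
  have v: "\<bar>v i\<bar> \<le> B + \<bar>c\<bar>" for i using bdd[of i] by (simp add: v_def)
  have D: "B + \<bar>c\<bar> \<ge> 0" using v[of 0] by simp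
  have sum_v: "(\<Sum>i<n. u i) - real n * c = sum v {..<n}" for n
    by (simp add: v_def sum_subtractf)
  have bl: "\<bar>\<Sum>i<N. v (k * N + i)\<bar> \<le> real N * \<eta>" if "k \<ge> K" for k
    using blocks[OF that] by (simp add: v_def sum_subtractf)
  have triv: "\<bar>\<Sum>i<m. v (p + i)\<bar> \<le> real m * (B + \<bar>c\<bar>)" for m p
    using sum_norm_bound[of "{..<m}" "\<lambda>i. v (p + i)" "B + \<bar>c\<bar>"] v by simp
  have split: "sum v {..<p + m} = sum v {..<p} + (\<Sum>i<m. v (p + i))" for p m
    by (induction m) (simp_all add: add.assoc)
  have mult: "\<bar>sum v {..<m * N}\<bar> \<le> real (m * N) * \<eta> + real (K * N) * (B + \<bar>c\<bar>)" for m
  proof (induction m)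
    case 0
    show ?case using D by simp
  next
    case (Suc m)
    show ?case
    proof (cases "K \<le> m")
      case True
      have "sum v {..<Suc m * N} = sum v {..<m * N} + (\<Sum>i<N. v (m * N + i))"
        using split[of "m * N" N] by (simp add: add.commute)
      moreover have "real (Suc m * N) * \<eta> = real (m * N) * \<eta> + real N * \<eta>"
        by (simp add: algebra_simps)
      ultimately show ?thesis using Suc bl[OF True] by linarith
    next
      case False
      have "Suc m * N \<le> K * N" using False by (intro mult_right_mono) auto
      then have "real (Suc m * N) * (B + \<bar>c\<bar>) \<le> real (K * N) * (B + \<bar>c\<bar>)"
        using D by (intro mult_right_mono) (simp_all only: of_nat_le_iff)
      moreover have "\<bar>sum v {..<Suc m * N}\<bar> \<le> real (Suc m * N) * (B + \<bar>c\<bar>)"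
        using triv[of 0 "Suc m * N"] by simp
      moreover have "0 \<le> real (Suc m * N) * \<eta>" using \<open>\<eta> \<ge> 0\<close> by simp
      ultimately show ?thesis by linarith
    qed
  qed
  define m r where "m = n div N" and "r = n mod N"
  have n: "n = m * N + r" "r < N" using N by (simp_all add: m_def r_def)
  have "sum v {..<n} = sum v {..<m * N} + (\<Sum>i<r. v (m * N + i))"
    using split[of "m * N" r] n by simp
  moreover have "real (m * N) * \<eta> \<le> real n * \<eta>"
    using n \<open>\<eta> \<ge> 0\<close> by (intro mult_right_mono) auto
  moreover have "real r * (B + \<bar>c\<bar>) \<le> real N * (B + \<bar>c\<bar>)"
    using n D by (intro mult_right_mono) auto
  moreover have "real ((K + 1) * N) * (B + \<bar>c\<bar>) = real (K * N) * (B + \<bar>c\<bar>) + real N * (B + \<bar>c\<bar>)"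
    by (simp add: algebra_simps)
  ultimately show ?thesis
    using mult[of m] triv[of "m * N" r] unfolding sum_v by linarith
qed

lemma block_averages:
  fixes u :: "nat \<Rightarrow> real"
  assumes bdd: "\<And>i. \<bar>u i\<bar> \<le> B" and N: "N > 0"
    and blocks: "\<And>k. k \<ge> K \<Longrightarrow> \<bar>(\<Sum>i<N. u (k * N + i)) - real N * c\<bar> \<le> real N * \<eta>"
    and "\<eta> \<ge> 0" "\<eta> < \<eta>'"
  shows "\<forall>\<^sub>F n in sequentially. \<bar>(\<Sum>i<n. u i) / real n - c\<bar> \<le> \<eta>'"
proof -
  define C where "C = real ((K + 1) * N) * (B + \<bar>c\<bar>)"
  have "(\<lambda>n. C / real n) \<longlonglongrightarrow> 0" by (rule lim_const_over_n)
  then have "\<forall>\<^sub>F n in sequentially. C / real n < \<eta>' - \<eta>"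
    by (rule order_tendstoD) (use assms in simp)
  then show ?thesis
    using eventually_gt_at_top[of 0]
  proof eventually_elim
    case (elim n)
    have "\<bar>(\<Sum>i<n. u i) / real n - c\<bar> = \<bar>(\<Sum>i<n. u i) - real n * c\<bar> / real n"
      using elim by (simp add: field_simps abs_divide [symmetric])
    also have "\<dots> \<le> (real n * \<eta> + C) / real n"
      using block_sums_bound[OF bdd N blocks \<open>\<eta> \<ge> 0\<close>, of K n] elim
      by (intro divide_right_mono) (simp_all add: C_def)
    also have "\<dots> = \<eta> + C / real n" using elim by (simp add: field_simps)
    finally show ?case using elim by linarith
  qed
qed

text \<open>The constant \<open>c\<close> may depend on \<open>\<eta>\<close>: that the averages eventually stay near some number, at every
  precision, already makes them a Cauchy sequence.\<close>

lemma averages_convergentI: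
  fixes u :: "nat \<Rightarrow> real"
  assumes bdd: "\<And>i. \<bar>u i\<bar> \<le> B"
    and blocks: "\<And>\<eta>. \<eta> > 0 \<Longrightarrow> \<exists>N K c. N > 0 \<and>
      (\<forall>k\<ge>K. \<bar>(\<Sum>i<N. u (k * N + i)) - real N * c\<bar> \<le> real N * \<eta>)"
  shows "convergent (\<lambda>n. (\<Sum>i<n. u i) / real n)"
proof -
  have "Cauchy (\<lambda>n. (\<Sum>i<n. u i) / real n)"
  proof (rule metric_CauchyI)
    fix e :: real assume e: "e > 0"
    obtain N K c where N: "N > 0"
      "\<And>k. k \<ge> K \<Longrightarrow> \<bar>(\<Sum>i<N. u (k * N + i)) - real N * c\<bar> \<le> real N * (e / 4)"
      using blocks[of "e / 4"] e by auto
    have "\<forall>\<^sub>F n in sequentially. \<bar>(\<Sum>i<n. u i) / real n - c\<bar> \<le> e / 3"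
      by (rule block_averages[OF bdd N]) (use e in auto)
    then obtain M where M: "\<And>n. n \<ge> M \<Longrightarrow> \<bar>(\<Sum>i<n. u i) / real n - c\<bar> \<le> e / 3"
      by (auto simp: eventually_sequentially)
    show "\<exists>M. \<forall>m\<ge>M. \<forall>n\<ge>M. dist ((\<Sum>i<m. u i) / real m) ((\<Sum>i<n. u i) / real n) < e"
    proof (intro exI allI impI)
      fix m n assume "m \<ge> M" "n \<ge> M"
      then show "dist ((\<Sum>i<m. u i) / real m) ((\<Sum>i<n. u i) / real n) < e"
        using M[of m] M[of n] e unfolding dist_real_def by linarith
    qed
  qed
  then show ?thesis by (rule Cauchy_convergent)
qed

section \<open>Equidistribution of irrational rotations\<close>

text \<open>The integer \<open>\<lfloor>x\<rfloor> - \<lfloor>x - L\<rfloor>\<close> counts the translates of an interval of length \<open>L\<close> that contain \<open>x\<close>. For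
  \<open>L = k * \<rho> + m\<close> the count along a rotation orbit deviates from \<open>L\<close> by a difference of values of
  the fractional part at times \<open>i\<close> and \<open>i + k\<close>. These differences telescope, leaving at most \<open>k\<close>
  terms at each end (the easy direction of Kesten's theorem on bounded discrepancy).\<close>

lemma rotation_bounded_discrepancy:
  fixes \<rho> s :: real and k n :: nat and m :: int
  defines "L \<equiv> real k * \<rho> + of_int m"
  shows "\<bar>(\<Sum>i<n. of_int (\<lfloor>s + real i * \<rho>\<rfloor> - \<lfloor>s + real i * \<rho> - L\<rfloor>)) - real n * L\<bar> \<le> real k"
proof -
  define c where "c i = frac (s - real k * \<rho> + real i * \<rho>)" for i
  have "of_int (\<lfloor>s + real i * \<rho>\<rfloor> - \<lfloor>s + real i * \<rho> - L\<rfloor>) = L - (c (i + k) - c i)" for i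
  proof -
    have "s + real i * \<rho> - L = (s - real k * \<rho> + real i * \<rho>) - of_int m"
      by (simp add: L_def algebra_simps)
    then have "\<lfloor>s + real i * \<rho> - L\<rfloor> = \<lfloor>s - real k * \<rho> + real i * \<rho>\<rfloor> - m"
      by (simp only: floor_diff_of_int)
    moreover have "s - real k * \<rho> + real (i + k) * \<rho> = s + real i * \<rho>"
      by (simp add: algebra_simps)
    ultimately show ?thesis by (simp add: c_def frac_def L_def algebra_simps)
  qed
  then have "(\<Sum>i<n. of_int (\<lfloor>s + real i * \<rho>\<rfloor> - \<lfloor>s + real i * \<rho> - L\<rfloor>)) - real n * L
      = - (\<Sum>i<n. c (i + k) - c i)"
    by (simp only: sum_subtractf) simp
  also have "(\<Sum>i<n. c (i + k) - c i) = (\<Sum>j<k. c (n + j) - c j)"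
  proof -
    have "(\<Sum>i<n. c (i + k)) + (\<Sum>j<k. c j) = (\<Sum>j<k. c (n + j)) + (\<Sum>i<n. c i)"
    proof (induction n)
      case (Suc n)
      have "(\<Sum>j<k. c (Suc n + j)) + c n = (\<Sum>j<k. c (n + j)) + c (n + k)"
        using sum.lessThan_Suc[of "\<lambda>j. c (n + j)" k] sum.lessThan_Suc_shift[of "\<lambda>j. c (n + j)" k]
        by simp
      then show ?case using Suc by simp
    qed simp
    then show ?thesis by (simp add: sum_subtractf)
  qed
  also have "\<bar>- (\<Sum>j<k. c (n + j) - c j)\<bar> \<le> real k"
  proof -
    have "\<bar>c (n + j) - c j\<bar> \<le> 1" for j
      unfolding c_def using frac_lt_1 frac_ge_0 by (smt (verit))
    then show ?thesis
      using sum_norm_bound[of "{..<k}" "\<lambda>j. c (n + j) - c j" 1] by simp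
  qed
  finally show ?thesis .
qed

lemma irrational_multiples_dense:
  fixes \<rho> :: real
  assumes "\<rho> \<notin> \<rat>" "a < b"
  obtains k :: nat and m :: int where "a < real k * \<rho> + of_int m" "real k * \<rho> + of_int m < b"
proof -
  define \<alpha> where "\<alpha> = (a + b) / 2"
  obtain k :: nat where k: "\<bar>frac (real k * \<rho>) - frac \<alpha>\<bar> < (b - a) / 2"
    using Kronecker_approx_1_explicit[OF assms(1), of "frac \<alpha>" "(b - a) / 2"] assms(2)
    by (metis diff_gt_0_iff_gt frac_ge_0 frac_lt_1 half_gt_zero less_imp_le)
  show ?thesis
  proof (rule that[of k "\<lfloor>\<alpha>\<rfloor> - \<lfloor>real k * \<rho>\<rfloor>"])
    have *: "real k * \<rho> + of_int (\<lfloor>\<alpha>\<rfloor> - \<lfloor>real k * \<rho>\<rfloor>) = \<alpha> + (frac (real k * \<rho>) - frac \<alpha>)"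
      by (simp add: frac_def)
    have \<alpha>: "\<alpha> = a / 2 + b / 2" by (simp add: \<alpha>_def add_divide_distrib)
    define e where "e = frac (real k * \<rho>) - frac \<alpha>"
    have e: "\<bar>e\<bar> < (b - a) / 2" using k by (simp add: e_def)
    show "a < real k * \<rho> + of_int (\<lfloor>\<alpha>\<rfloor> - \<lfloor>real k * \<rho>\<rfloor>)"
      unfolding * e_def[symmetric] using e \<alpha> by argo
    show "real k * \<rho> + of_int (\<lfloor>\<alpha>\<rfloor> - \<lfloor>real k * \<rho>\<rfloor>) < b"
      unfolding * e_def[symmetric] using e \<alpha> by argo
  qed
qed

text \<open>The count is monotone in \<open>L\<close>, and the lengths with bounded discrepancy are dense, so an arbitrary
  \<open>L\<close> is squeezed between two of them. The discrepancy bound does not mention the starting point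
  \<open>s\<close>, whence the uniformity.\<close>

lemma irrational_rotation_equidistributed:
  fixes \<rho> L \<eta> :: real
  assumes \<rho>: "\<rho> \<notin> \<rat>" and \<eta>: "\<eta> > 0"
  shows "\<exists>N. \<forall>n\<ge>N. \<forall>s.
    \<bar>(\<Sum>i<n. of_int (\<lfloor>s + real i * \<rho>\<rfloor> - \<lfloor>s + real i * \<rho> - L\<rfloor>)) - real n * L\<bar> \<le> real n * \<eta>"
proof -
  obtain k1 :: nat and m1 where 1: "L - \<eta> / 2 < real k1 * \<rho> + of_int m1" "real k1 * \<rho> + of_int m1 < L"
    using irrational_multiples_dense[OF \<rho>, of "L - \<eta> / 2" L] \<eta> by auto
  obtain k2 :: nat and m2 where 2: "L < real k2 * \<rho> + of_int m2" "real k2 * \<rho> + of_int m2 < L + \<eta> / 2"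
    using irrational_multiples_dense[OF \<rho>, of L "L + \<eta> / 2"] \<eta> by auto
  obtain N :: nat where N: "real (k1 + k2) * 2 / \<eta> < real N"
    using reals_Archimedean2 by blast
  show ?thesis
  proof (intro exI[of _ N] allI impI)
    fix n :: nat and s :: real assume "N \<le> n"
    then have "real (k1 + k2) * 2 / \<eta> \<le> real n" using N by linarith
    then have n: "real (k1 + k2) \<le> real n * (\<eta> / 2)" using \<eta> by (simp add: field_simps)
    define D :: "real \<Rightarrow> real" where "D t = (\<Sum>i<n. of_int (\<lfloor>s + real i * \<rho>\<rfloor> - \<lfloor>s + real i * \<rho> - t\<rfloor>))" for t
    have D_mono: "D t \<le> D t'" if "t \<le> t'" for t t'
      unfolding D_def using that by (intro sum_mono) (simp add: floor_mono)
    have "\<bar>D (real k1 * \<rho> + of_int m1) - real n * (real k1 * \<rho> + of_int m1)\<bar> \<le> real k1"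
      "\<bar>D (real k2 * \<rho> + of_int m2) - real n * (real k2 * \<rho> + of_int m2)\<bar> \<le> real k2"
      unfolding D_def by (rule rotation_bounded_discrepancy)+
    moreover have "D (real k1 * \<rho> + of_int m1) \<le> D L" "D L \<le> D (real k2 * \<rho> + of_int m2)"
      using 1 2 by (auto intro!: D_mono)
    moreover have "real n * (L - \<eta> / 2) \<le> real n * (real k1 * \<rho> + of_int m1)"
      "real n * (real k2 * \<rho> + of_int m2) \<le> real n * (L + \<eta> / 2)"
      using 1 2 by (intro mult_left_mono; simp)+
    ultimately have "\<bar>D L - real n * L\<bar> \<le> real n * \<eta>"
      using n unfolding right_diff_distrib distrib_left[of "real n" L] by (simp add: abs_le_iff)
    then show "\<bar>(\<Sum>i<n. of_int (\<lfloor>s + real i * \<rho>\<rfloor> - \<lfloor>s + real i * \<rho> - L\<rfloor>)) - real n * L\<bar> \<le> real n * \<eta>"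
      by (simp add: D_def)
  qed
qed

section \<open>Lifts of degree one and their translation number\<close>

text \<open>The lifts to the real line of the orientation preserving homeomorphisms of the circle.\<close>

locale circle_lift =
  fixes F :: "real \<Rightarrow> real"
  assumes cont: "continuous_on UNIV F"
    and strict_mono: "strict_mono F"
    and shift_one: "F (x + 1) = F x + 1"
begin

lemma shift_nat: "F (x + real m) = F x + real m"
  by (induction m) (use shift_one in \<open>simp_all add: add.assoc [symmetric] add.commute[of 1]\<close>)

lemma shift_int: "F (x + of_int m) = F x + of_int m"
proof (cases m)
  case (nonneg n)
  then show ?thesis using shift_nat by simp
next
  case (neg n)
  then show ?thesis using shift_nat[of "x + of_int m" "Suc n"] by simp
qed

lemma mono_iter: "x \<le> y \<Longrightarrow> (F ^^ n) x \<le> (F ^^ n) y"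
  by (induction n) (use strict_mono in \<open>auto simp: strict_mono_less_eq\<close>)

lemma iter_shift_int: "(F ^^ n) (x + of_int m) = (F ^^ n) x + of_int m"
  by (induction n) (auto simp: shift_int)

lemma cont_iter: "continuous_on UNIV (F ^^ n)"
proof (induction n)
  case (Suc n)
  then show ?case
    using continuous_on_compose2[OF cont Suc] by (simp add: o_def)
qed (simp add: id_def)

lemma isCont_iter: "isCont (F ^^ n) x"
  using cont_iter by (simp add: continuous_on_eq_continuous_at)

text \<open>A monotone map of degree one moves all points of a unit interval by almost the same amount.\<close>

lemma iter_displacement_close: "\<bar>((F ^^ n) x - x) - (F ^^ n) 0\<bar> \<le> 1"
proof -
  have "(F ^^ n) (of_int \<lfloor>x\<rfloor>) \<le> (F ^^ n) x" "(F ^^ n) x \<le> (F ^^ n) (of_int (\<lfloor>x\<rfloor> + 1))"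
    by (intro mono_iter; linarith)+
  then show ?thesis
    using iter_shift_int[of n 0 "\<lfloor>x\<rfloor>"] iter_shift_int[of n 0 "\<lfloor>x\<rfloor> + 1"] by simp linarith
qed

definition translation_number :: real where
  "translation_number = lim (\<lambda>n. (F ^^ n) 0 / real n)"

text \<open>The sequence of iterates of \<open>0\<close> is additive up to an error of one, so its rates of growth at times
  \<open>m\<close> and \<open>n\<close> can both be compared with the one at time \<open>m * n\<close>.\<close>

lemma iter_mult_close: "\<bar>(F ^^ (k * n)) 0 - real k * (F ^^ n) 0\<bar> \<le> real k"
proof (induction k)
  case (Suc k)
  have "(F ^^ (Suc k * n)) 0 = (F ^^ n) ((F ^^ (k * n)) 0)"
    by (simp add: funpow_add)
  moreover have "real (Suc k) * (F ^^ n) 0 = real k * (F ^^ n) 0 + (F ^^ n) 0"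
    by (simp add: algebra_simps)
  ultimately show ?case
    using Suc iter_displacement_close[of n "(F ^^ (k * n)) 0"] by linarith
qed simp

lemma translation_number_rate:
  assumes "m > 0" "n > 0"
  shows "\<bar>(F ^^ m) 0 / real m - (F ^^ n) 0 / real n\<bar> \<le> 1 / real m + 1 / real n"
proof -
  have "\<bar>real m * (F ^^ n) 0 - real n * (F ^^ m) 0\<bar> \<le> real m + real n"
    using iter_mult_close[of m n] iter_mult_close[of n m] by (simp add: mult.commute)
  then have "\<bar>real n * (F ^^ m) 0 - real m * (F ^^ n) 0\<bar> / (real m * real n)
      \<le> (real m + real n) / (real m * real n)"
    by (intro divide_right_mono) (auto simp: abs_minus_commute)
  moreover have "\<bar>real n * (F ^^ m) 0 - real m * (F ^^ n) 0\<bar> / (real m * real n) =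
      \<bar>(F ^^ m) 0 / real m - (F ^^ n) 0 / real n\<bar>"
    using assms by (simp add: abs_div_pos diff_divide_distrib)
  moreover have "(real m + real n) / (real m * real n) = 1 / real m + 1 / real n"
    using assms by (simp add: field_simps)
  ultimately show ?thesis by linarith
qed

lemma translation_number_LIMSEQ: "(\<lambda>n. (F ^^ n) 0 / real n) \<longlonglongrightarrow> translation_number"
proof -
  have "Cauchy (\<lambda>n. (F ^^ n) 0 / real n)"
  proof (rule metric_CauchyI)
    fix e :: real assume e: "e > 0"
    obtain M :: nat where M: "2 / e < real M" using reals_Archimedean2 by blast
    have M0: "M > 0" using M e by (cases M) (auto simp: field_simps not_less)
    have small: "1 / real m < e / 2" if "m \<ge> M" for m
    proof -
      have "2 / e < real m" using M that by linarith
      then show ?thesis using e that M0 by (simp add: field_simps)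
    qed
    show "\<exists>M. \<forall>m\<ge>M. \<forall>n\<ge>M. dist ((F ^^ m) 0 / real m) ((F ^^ n) 0 / real n) < e"
    proof (intro exI allI impI)
      fix m n assume mn: "M \<le> m" "M \<le> n"
      then show "dist ((F ^^ m) 0 / real m) ((F ^^ n) 0 / real n) < e"
        using translation_number_rate[of m n] small[of m] small[of n] M0
        unfolding dist_real_def by auto
    qed
  qed
  then show ?thesis
    unfolding translation_number_def by (simp add: Cauchy_convergent_iff convergent_LIMSEQ_iff)
qed

text \<open>A bounded deviation from the translation by \<^const>\<open>translation_number\<close>. It makes the semiconjugacy
  below finite, and it bounds orbits in the rational case.\<close>

lemma iter_bounded: "\<bar>(F ^^ n) x - x - real n * translation_number\<bar> \<le> 2"
proof -
  have "\<bar>(F ^^ n) 0 - real n * translation_number\<bar> \<le> 1"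
  proof (cases "n = 0")
    case False
    have "(\<lambda>m. 1 / real m + 1 / real n) \<longlonglongrightarrow> 0 + 1 / real n"
      by (intro tendsto_intros lim_1_over_n)
    moreover have "(\<lambda>m. \<bar>(F ^^ m) 0 / real m - (F ^^ n) 0 / real n\<bar>)
        \<longlonglongrightarrow> \<bar>translation_number - (F ^^ n) 0 / real n\<bar>"
      by (intro tendsto_intros translation_number_LIMSEQ)
    moreover have "\<forall>\<^sub>F m in sequentially.
        \<bar>(F ^^ m) 0 / real m - (F ^^ n) 0 / real n\<bar> \<le> 1 / real m + 1 / real n"
      using eventually_gt_at_top[of 0]
      by eventually_elim (use translation_number_rate False in auto)
    ultimately have "\<bar>translation_number - (F ^^ n) 0 / real n\<bar> \<le> 0 + 1 / real n"
      by (rule tendsto_le[OF sequentially_bot])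
    then have "real n * \<bar>translation_number - (F ^^ n) 0 / real n\<bar> \<le> real n * (1 / real n)"
      by (intro mult_left_mono) auto
    moreover have "real n * \<bar>translation_number - (F ^^ n) 0 / real n\<bar>
        = \<bar>real n * (translation_number - (F ^^ n) 0 / real n)\<bar>"
      by (simp add: abs_mult)
    moreover have "real n * (translation_number - (F ^^ n) 0 / real n) = real n * translation_number - (F ^^ n) 0"
      using False by (simp add: right_diff_distrib)
    ultimately show ?thesis using False by (simp add: abs_minus_commute)
  qed simp
  then show ?thesis using iter_displacement_close[of n x] by linarith
qed

end

section \<open>Semiconjugacy to a translation\<close>

lemma cSUP_add_const:
  fixes f :: "nat \<Rightarrow> real"
  assumes "bdd_above (range f)"
  shows "(SUP n. f n + c) = (SUP n. f n) + c"
proof (rule antisym)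
  show "(SUP n. f n + c) \<le> (SUP n. f n) + c"
    using assms by (intro cSUP_least add_right_mono cSUP_upper) auto
  have "bdd_above (range (\<lambda>n. f n + c))"
    using assms by (auto simp: bdd_above_def) (metis add_right_mono)
  then have "f n \<le> (SUP n. f n + c) - c" for n
    using cSUP_upper[of n UNIV "\<lambda>n. f n + c"] by simp
  then have "(SUP n. f n) \<le> (SUP n. f n + c) - c" by (intro cSUP_least) auto
  then show "(SUP n. f n) + c \<le> (SUP n. f n + c)" by simp
qed

context circle_lift
begin

text \<open>The limit superior of \<open>F\<^sup>n x - n * translation_number\<close>. As a limit superior it is unaffected by
  shifting \<open>n\<close>, which makes it semiconjugate \<open>F\<close> to a translation, and it inherits monotonicity and degree
  one from \<open>F\<close>. Its monotonicity transports counts of visits.\<close>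

definition semiconj :: "real \<Rightarrow> real" where
  "semiconj x = lim (\<lambda>N. SUP n. (F ^^ (n + N)) x - real (n + N) * translation_number)"

lemma semiconj_sup_bounds:
  "bdd_above (range (\<lambda>n. (F ^^ (n + N)) x - real (n + N) * translation_number))"
proof (rule bdd_aboveI2)
  show "(F ^^ (n + N)) x - real (n + N) * translation_number \<le> x + 2" for n
    using iter_bounded[of "n + N" x] by linarith
qed

lemma semiconj_sup_decseq:
  "decseq (\<lambda>N. SUP n. (F ^^ (n + N)) x - real (n + N) * translation_number)"
proof (rule decseq_SucI, rule cSUP_mono)
  fix N n :: nat
  show "\<exists>m\<in>UNIV. (F ^^ (n + Suc N)) x - real (n + Suc N) * translation_number
      \<le> (F ^^ (m + N)) x - real (m + N) * translation_number"
    by (rule bexI[of _ "Suc n"]) simp_all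
qed (simp_all only: semiconj_sup_bounds UNIV_not_empty not_False_eq_True)

lemma semiconj_LIMSEQ:
  "(\<lambda>N. SUP n. (F ^^ (n + N)) x - real (n + N) * translation_number) \<longlonglongrightarrow> semiconj x"
proof -
  have "x - 2 \<le> (SUP n. (F ^^ (n + N)) x - real (n + N) * translation_number)" for N
    by (rule cSUP_upper2[OF semiconj_sup_bounds UNIV_I[of 0]]) (use iter_bounded[of N x] in simp)
  then obtain L where "(\<lambda>N. SUP n. (F ^^ (n + N)) x - real (n + N) * translation_number) \<longlonglongrightarrow> L"
    using decseq_convergent[OF semiconj_sup_decseq, of "x - 2" x] by metis
  then show ?thesis unfolding semiconj_def using limI by fastforce
qed

lemma semiconj_mono: "x \<le> y \<Longrightarrow> semiconj x \<le> semiconj y"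
proof (rule tendsto_le[OF sequentially_bot semiconj_LIMSEQ semiconj_LIMSEQ])
  assume "x \<le> y"
  then show "\<forall>\<^sub>F N in sequentially. (SUP n. (F ^^ (n + N)) x - real (n + N) * translation_number)
      \<le> (SUP n. (F ^^ (n + N)) y - real (n + N) * translation_number)"
    by (intro always_eventually allI cSUP_mono semiconj_sup_bounds)
      (auto intro!: diff_right_mono mono_iter)
qed

lemma semiconj_shift: "semiconj (x + of_int m) = semiconj x + of_int m"
proof (rule LIMSEQ_unique[OF semiconj_LIMSEQ])
  have "(SUP n. (F ^^ (n + N)) (x + of_int m) - real (n + N) * translation_number)
      = (SUP n. (F ^^ (n + N)) x - real (n + N) * translation_number) + of_int m" for N
  proof -
    have "(SUP n. (F ^^ (n + N)) (x + of_int m) - real (n + N) * translation_number)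
        = (SUP n. ((F ^^ (n + N)) x - real (n + N) * translation_number) + of_int m)"
      by (simp add: iter_shift_int algebra_simps)
    also have "\<dots> = (SUP n. (F ^^ (n + N)) x - real (n + N) * translation_number) + of_int m"
      by (rule cSUP_add_const[OF semiconj_sup_bounds])
    finally show ?thesis .
  qed
  then show "(\<lambda>N. SUP n. (F ^^ (n + N)) (x + of_int m) - real (n + N) * translation_number)
      \<longlonglongrightarrow> semiconj x + of_int m"
    using tendsto_add[OF semiconj_LIMSEQ tendsto_const] by simp
qed

lemma semiconj_step: "semiconj (F x) = semiconj x + translation_number"
proof (rule LIMSEQ_unique[OF semiconj_LIMSEQ])
  let ?s = "\<lambda>N. SUP n. (F ^^ (n + N)) x - real (n + N) * translation_number"
  have "(SUP n. (F ^^ (n + N)) (F x) - real (n + N) * translation_number)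
      = ?s (Suc N) + translation_number" for N
  proof -
    have "(F ^^ (n + N)) (F x) = (F ^^ (n + Suc N)) x" for n
      by (simp add: funpow_swap1)
    then have "(SUP n. (F ^^ (n + N)) (F x) - real (n + N) * translation_number)
        = (SUP n. ((F ^^ (n + Suc N)) x - real (n + Suc N) * translation_number) + translation_number)"
      by (simp add: algebra_simps del: funpow.simps)
    also have "\<dots> = ?s (Suc N) + translation_number"
      by (rule cSUP_add_const[OF semiconj_sup_bounds])
    finally show ?thesis .
  qed
  then show "(\<lambda>N. SUP n. (F ^^ (n + N)) (F x) - real (n + N) * translation_number)
      \<longlonglongrightarrow> semiconj x + translation_number"
    using tendsto_add[OF LIMSEQ_Suc[OF semiconj_LIMSEQ] tendsto_const] by simp
qed

lemma semiconj_iter: "semiconj ((F ^^ n) x) = semiconj x + real n * translation_number"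
  by (induction n) (simp_all add: semiconj_step algebra_simps)

end

section \<open>Uniform equidistribution of orbits\<close>

context circle_lift
begin

text \<open>Monotonicity gives \<open>\<lfloor>y - c\<rfloor> \<le> \<lfloor>semiconj y - semiconj c\<rfloor>\<close>, and conversely \<open>\<lfloor>y - c\<rfloor>\<close> is at least the
  same quantity with any \<open>d > 0\<close> subtracted inside. So the visits of an orbit of \<open>F\<close> to \<open>[a,b)\<close> are
  squeezed between visits of rotation orbits to intervals of lengths
  \<open>semiconj b - semiconj a \<plusminus> d\<close>.\<close>

lemma visits_frequency:
  assumes irr: "translation_number \<notin> \<rat>" and \<eta>: "\<eta> > 0"
  shows "\<exists>N. \<forall>n\<ge>N. \<forall>x.
    \<bar>(\<Sum>i<n. of_int (\<lfloor>(F ^^ i) x - a\<rfloor> - \<lfloor>(F ^^ i) x - b\<rfloor>)) - real n * (semiconj b - semiconj a)\<bar>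
      \<le> real n * \<eta>"
proof -
  define L where "L = semiconj b - semiconj a"
  define d where "d = \<eta> / 2"
  have d: "d > 0" "\<eta> = d + d" using \<eta> by (simp_all add: d_def)
  define D :: "nat \<Rightarrow> real \<Rightarrow> real \<Rightarrow> real" where
    "D n s t = (\<Sum>i<n. of_int (\<lfloor>s + real i * translation_number\<rfloor> - \<lfloor>s + real i * translation_number - t\<rfloor>))" for n s t
  have equi: "\<exists>N. \<forall>n\<ge>N. \<forall>s. \<bar>D n s t - real n * t\<bar> \<le> real n * d" for t
    unfolding D_def by (rule irrational_rotation_equidistributed[OF irr d(1)])
  obtain N1 where N1: "\<forall>n\<ge>N1. \<forall>s. \<bar>D n s (L - d) - real n * (L - d)\<bar> \<le> real n * d"
    using equi by blast
  obtain N2 where N2: "\<forall>n\<ge>N2. \<forall>s. \<bar>D n s (L + d) - real n * (L + d)\<bar> \<le> real n * d"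
    using equi by blast
  have upper: "\<lfloor>y - c\<rfloor> \<le> \<lfloor>semiconj y - semiconj c\<rfloor>" for y c
  proof -
    have "semiconj (c + of_int \<lfloor>y - c\<rfloor>) \<le> semiconj y"
      by (rule semiconj_mono) linarith
    then show ?thesis by (simp add: semiconj_shift le_floor_iff)
  qed
  have lower: "\<lfloor>semiconj y - semiconj c - d\<rfloor> \<le> \<lfloor>y - c\<rfloor>" for y c
  proof -
    have "semiconj y \<le> semiconj (c + of_int (\<lfloor>y - c\<rfloor> + 1))"
      by (rule semiconj_mono) linarith
    then have "semiconj y - semiconj c - d < of_int (\<lfloor>y - c\<rfloor> + 1)"
      unfolding semiconj_shift using d(1) by simp
    then have "\<lfloor>semiconj y - semiconj c - d\<rfloor> < \<lfloor>y - c\<rfloor> + 1"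
      by (simp only: floor_less_iff)
    then show ?thesis by simp
  qed
  show ?thesis
  proof (intro exI[of _ "max N1 N2"] allI impI)
    fix n :: nat and x assume n: "n \<ge> max N1 N2"
    let ?V = "\<Sum>i<n. of_int (\<lfloor>(F ^^ i) x - a\<rfloor> - \<lfloor>(F ^^ i) x - b\<rfloor>) :: real"
    define s where "s = semiconj x - semiconj a"
    have "?V \<le> D n s (L + d)"
      unfolding D_def
    proof (intro sum_mono)
      fix i
      have e: "semiconj ((F ^^ i) x) - semiconj a = s + real i * translation_number"
        "semiconj ((F ^^ i) x) - semiconj b - d = s + real i * translation_number - (L + d)"
        by (simp_all add: semiconj_iter s_def L_def algebra_simps)
      then have "\<lfloor>(F ^^ i) x - a\<rfloor> \<le> \<lfloor>s + real i * translation_number\<rfloor>"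
        "\<lfloor>s + real i * translation_number - (L + d)\<rfloor> \<le> \<lfloor>(F ^^ i) x - b\<rfloor>"
        using upper[of "(F ^^ i) x" a] lower[of "(F ^^ i) x" b] unfolding e by (blast, blast)
      then show "of_int (\<lfloor>(F ^^ i) x - a\<rfloor> - \<lfloor>(F ^^ i) x - b\<rfloor>) \<le> (of_int (\<lfloor>s + real i * translation_number\<rfloor>
          - \<lfloor>s + real i * translation_number - (L + d)\<rfloor>) :: real)"
        by (intro of_int_le_iff[THEN iffD2]) linarith
    qed
    moreover have "D n (s - d) (L - d) \<le> ?V"
      unfolding D_def
    proof (intro sum_mono)
      fix i
      have e: "semiconj ((F ^^ i) x) - semiconj a - d = s - d + real i * translation_number"
        "semiconj ((F ^^ i) x) - semiconj b = s - d + real i * translation_number - (L - d)"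
        by (simp_all add: semiconj_iter s_def L_def algebra_simps)
      then have "\<lfloor>s - d + real i * translation_number\<rfloor> \<le> \<lfloor>(F ^^ i) x - a\<rfloor>"
        "\<lfloor>(F ^^ i) x - b\<rfloor> \<le> \<lfloor>s - d + real i * translation_number - (L - d)\<rfloor>"
        using lower[of "(F ^^ i) x" a] upper[of "(F ^^ i) x" b] unfolding e by (blast, blast)
      then show "(of_int (\<lfloor>s - d + real i * translation_number\<rfloor>
          - \<lfloor>s - d + real i * translation_number - (L - d)\<rfloor>) :: real)
          \<le> of_int (\<lfloor>(F ^^ i) x - a\<rfloor> - \<lfloor>(F ^^ i) x - b\<rfloor>)"
        by (intro of_int_le_iff[THEN iffD2]) linarith
    qed
    moreover have "\<bar>D n (s - d) (L - d) - real n * (L - d)\<bar> \<le> real n * d"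
      "\<bar>D n s (L + d) - real n * (L + d)\<bar> \<le> real n * d"
      using n N1 N2 by simp_all
    moreover have "real n * \<eta> = real n * d + real n * d"
      "real n * (L - d) = real n * L - real n * d" "real n * (L + d) = real n * L + real n * d"
      unfolding d(2) by (simp_all add: algebra_simps)
    ultimately show "\<bar>?V - real n * (semiconj b - semiconj a)\<bar> \<le> real n * \<eta>"
      unfolding L_def[symmetric] by linarith
  qed
qed

end

lemma periodic_uniformly_continuous:
  fixes g :: "real \<Rightarrow> 'a::metric_space"
  assumes "continuous_on UNIV g" "\<And>x m. g (x + of_int m) = g x"
  shows "uniformly_continuous_on UNIV g"
proof -
  have uc: "uniformly_continuous_on {-1..2} g"
    using assms(1) by (intro compact_uniformly_continuous) (auto intro: continuous_on_subset)
  show ?thesis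
    unfolding uniformly_continuous_on_def
  proof (intro allI impI)
    fix e :: real assume "e > 0"
    then obtain d where d: "d > 0" "\<And>x y. x \<in> {-1..2} \<Longrightarrow> y \<in> {-1..2} \<Longrightarrow> dist y x < d \<Longrightarrow> dist (g y) (g x) < e"
      using uc unfolding uniformly_continuous_on_def by metis
    show "\<exists>d>0. \<forall>x\<in>UNIV. \<forall>y\<in>UNIV. dist y x < d \<longrightarrow> dist (g y) (g x) < e"
    proof (intro exI[of _ "min d 1"] conjI ballI impI)
      fix x y :: real assume xy: "dist y x < min d 1"
      define k where "k = - \<lfloor>x\<rfloor>"
      have "x + of_int k \<in> {-1..2}" "y + of_int k \<in> {-1..2}" "dist (y + of_int k) (x + of_int k) < d"
        using xy unfolding k_def dist_real_def by (simp; linarith)+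
      then have "dist (g (y + of_int k)) (g (x + of_int k)) < e" by (intro d)
      then show "dist (g y) (g x) < e" by (simp add: assms(2))
    qed (use d in simp)
  qed
qed

text \<open>The differences of floors used to count visits are, for the partition of the circle into \<open>M\<close> equal
  arcs, the indicator functions of these arcs.\<close>

lemma floor_difference_arc:
  fixes x :: real and j M :: nat
  assumes "j < M"
  shows "\<lfloor>x - real j / real M\<rfloor> - \<lfloor>x - real (Suc j) / real M\<rfloor> = of_bool (j = nat \<lfloor>real M * frac x\<rfloor>)"
proof -
  define y where "y = frac x"
  have y: "0 \<le> y" "y < 1" unfolding y_def by (auto simp: frac_lt_1)
  have M: "M > 0" using assms by simp
  have step: "\<lfloor>y - t / real M\<rfloor> = (if t \<le> real M * y then 0 else -1)" if "0 \<le> t" "t \<le> real M" for t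
  proof -
    have "0 \<le> t / real M" "t / real M \<le> 1" using that M by (auto simp: field_simps)
    moreover have "t \<le> real M * y \<longleftrightarrow> t / real M \<le> y" using M by (simp add: field_simps)
    ultimately show ?thesis using y by (auto intro!: floor_unique)
  qed
  have shift: "\<lfloor>x - t\<rfloor> = \<lfloor>y - t\<rfloor> + \<lfloor>x\<rfloor>" for t
  proof -
    have "x - t = (y - t) + of_int \<lfloor>x\<rfloor>" by (simp add: y_def frac_def)
    then show ?thesis by (simp only: floor_add_int)
  qed
  have nn: "0 \<le> real M * y" using y by simp
  have "j = nat \<lfloor>real M * y\<rfloor> \<longleftrightarrow> int j = \<lfloor>real M * y\<rfloor>"
    using nn by (metis int_nat_eq nat_int zero_le_floor)
  also have "\<dots> \<longleftrightarrow> real j \<le> real M * y \<and> real M * y < real j + 1"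
    by (auto simp: floor_eq_iff eq_commute[of "int j"])
  finally have *: "j = nat \<lfloor>real M * y\<rfloor> \<longleftrightarrow> real j \<le> real M * y \<and> real M * y < real j + 1" .
  show ?thesis
    unfolding shift y_def[symmetric] *
    using step[of "real j"] step[of "real (Suc j)"] assms by auto
qed

lemma step_function_approx:
  fixes g :: "real \<Rightarrow> real"
  assumes M: "M > 0" and per: "\<And>x m. g (x + of_int m) = g x"
    and close: "\<And>x y. \<bar>x - y\<bar> \<le> 1 / real M \<Longrightarrow> \<bar>g x - g y\<bar> \<le> \<eta>"
  shows "\<bar>g x - (\<Sum>j<M. g (real j / real M) *
    of_int (\<lfloor>x - real j / real M\<rfloor> - \<lfloor>x - real (Suc j) / real M\<rfloor>))\<bar> \<le> \<eta>"
proof -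
  define j where "j = nat \<lfloor>real M * frac x\<rfloor>"
  have j1: "real j \<le> real M * frac x" "real M * frac x < real j + 1"
    unfolding j_def by (simp_all add: of_nat_nat)
  have "real M * frac x < real M * 1" using M frac_lt_1[of x] by (intro mult_strict_left_mono) auto
  then have j: "j < M" using j1 by linarith
  have "(\<Sum>k<M. g (real k / real M) * of_int (\<lfloor>x - real k / real M\<rfloor> - \<lfloor>x - real (Suc k) / real M\<rfloor>))
      = (\<Sum>k<M. if k = j then g (real k / real M) else 0)"
    unfolding j_def by (intro sum.cong refl, subst floor_difference_arc) (auto simp: Suc_le_eq)
  also have "\<dots> = g (real j / real M)" using j by simp
  finally have eq: "(\<Sum>k<M. g (real k / real M) * of_int (\<lfloor>x - real k / real M\<rfloor> - \<lfloor>x - real (Suc k) / real M\<rfloor>))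
      = g (real j / real M)" .
  have "g x = g (frac x)" using per[of "frac x" "\<lfloor>x\<rfloor>"] by (simp add: frac_def)
  moreover have "\<bar>g (frac x) - g (real j / real M)\<bar> \<le> \<eta>"
  proof (rule close)
    have "real j / real M \<le> frac x" "frac x \<le> (real j + 1) / real M"
      using j1 M by (simp_all add: pos_divide_le_eq pos_le_divide_eq mult.commute less_imp_le)
    then show "\<bar>frac x - real j / real M\<bar> \<le> 1 / real M" by (simp add: add_divide_distrib)
  qed
  ultimately show ?thesis unfolding eq by simp
qed

context circle_lift
begin

text \<open>Unique ergodicity in quantitative form. Only the finitely many visiting frequencies of the arcs of
  one partition are involved, and the fineness of that partition depends on \<open>\<delta>\<close> alone; hence \<open>N\<close>
  serves all observables \<open>g\<close> with the same bound and modulus of continuity.\<close>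

theorem equiuniform_equidistribution:
  assumes irr: "translation_number \<notin> \<rat>" and "\<delta> > 0" and \<eta>: "\<eta> > 0"
  obtains N where "N > 0" "\<And>n g. n \<ge> N \<Longrightarrow> (\<And>x m. g (x + of_int m) = g x) \<Longrightarrow> (\<And>x. \<bar>g x\<bar> \<le> 1)
      \<Longrightarrow> (\<And>x y. \<bar>x - y\<bar> < \<delta> \<Longrightarrow> \<bar>g x - g y\<bar> \<le> \<eta> / 2)
      \<Longrightarrow> \<exists>c. \<forall>x. \<bar>(\<Sum>i<n. g ((F ^^ i) x)) - real n * c\<bar> \<le> real n * \<eta>"
proof -
  obtain M :: nat where M: "1 / \<delta> < real M" using reals_Archimedean2 by blast
  have M0: "M > 0" using M \<open>\<delta> > 0\<close> by (cases M) (auto simp: field_simps not_less)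
  have M\<delta>: "1 / real M < \<delta>" using M \<open>\<delta> > 0\<close> M0 by (simp add: field_simps)
  define e where "e = \<eta> / (2 * real M)"
  have e: "e > 0" using M0 \<eta> by (simp add: e_def)
  define V :: "nat \<Rightarrow> nat \<Rightarrow> real \<Rightarrow> real" where
    "V j n x = (\<Sum>i<n. of_int (\<lfloor>(F ^^ i) x - real j / real M\<rfloor> - \<lfloor>(F ^^ i) x - real (Suc j) / real M\<rfloor>))"
    for j n x
  define p where "p j = semiconj (real (Suc j) / real M) - semiconj (real j / real M)" for j
  have "\<exists>N. \<forall>n\<ge>N. \<forall>x. \<bar>V j n x - real n * p j\<bar> \<le> real n * e" for j
    unfolding p_def V_def by (rule visits_frequency[OF irr e])
  then obtain N where N: "\<And>j n x. n \<ge> N j \<Longrightarrow> \<bar>V j n x - real n * p j\<bar> \<le> real n * e"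
    by metis
  show ?thesis
  proof (rule that[of "Suc (\<Sum>j<M. N j)"])
    fix n :: nat and g :: "real \<Rightarrow> real"
    assume n: "n \<ge> Suc (\<Sum>j<M. N j)" and per: "\<And>x m. g (x + of_int m) = g x"
      and bdd: "\<And>x. \<bar>g x\<bar> \<le> 1" and close: "\<And>x y. \<bar>x - y\<bar> < \<delta> \<Longrightarrow> \<bar>g x - g y\<bar> \<le> \<eta> / 2"
    have "\<bar>(\<Sum>i<n. g ((F ^^ i) x)) - real n * (\<Sum>j<M. g (real j / real M) * p j)\<bar> \<le> real n * \<eta>" for x
    proof -
      define w where "w y = (\<Sum>j<M. g (real j / real M) *
        of_int (\<lfloor>y - real j / real M\<rfloor> - \<lfloor>y - real (Suc j) / real M\<rfloor>))" for y
      have w: "\<bar>g y - w y\<bar> \<le> \<eta> / 2" for y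
        unfolding w_def
      proof (rule step_function_approx[OF M0 per])
        fix x y :: real assume "\<bar>x - y\<bar> \<le> 1 / real M"
        then show "\<bar>g x - g y\<bar> \<le> \<eta> / 2" using M\<delta> by (intro close) linarith
      qed
      have "\<bar>\<Sum>i<n. g ((F ^^ i) x) - w ((F ^^ i) x)\<bar> \<le> real n * (\<eta> / 2)"
        using sum_norm_bound[of "{..<n}" "\<lambda>i. g ((F ^^ i) x) - w ((F ^^ i) x)" "\<eta> / 2"] w by simp
      moreover have "(\<Sum>i<n. w ((F ^^ i) x)) = (\<Sum>j<M. g (real j / real M) * V j n x)"
        unfolding w_def V_def by (subst sum.swap) (simp only: sum_distrib_left)
      moreover have "\<bar>\<Sum>j<M. g (real j / real M) * (V j n x - real n * p j)\<bar> \<le> real n * (\<eta> / 2)"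
      proof -
        have "\<bar>g (real j / real M) * (V j n x - real n * p j)\<bar> \<le> real n * e" if "j < M" for j
        proof -
          have "N j \<le> (\<Sum>j<M. N j)" using that by (intro member_le_sum) auto
          then have "\<bar>V j n x - real n * p j\<bar> \<le> real n * e" using n by (intro N) auto
          then have "\<bar>g (real j / real M)\<bar> * \<bar>V j n x - real n * p j\<bar> \<le> 1 * (real n * e)"
            using bdd by (intro mult_mono) auto
          then show ?thesis by (simp only: abs_mult mult_1)
        qed
        then have "\<bar>\<Sum>j<M. g (real j / real M) * (V j n x - real n * p j)\<bar> \<le> real M * (real n * e)"
          using sum_norm_bound[of "{..<M}" "\<lambda>j. g (real j / real M) * (V j n x - real n * p j)" "real n * e"]
          by (simp only: card_lessThan real_norm_def lessThan_iff)
        also have "\<dots> = real n * (\<eta> / 2)" using M0 by (simp add: e_def)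
        finally show ?thesis .
      qed
      moreover have "(\<Sum>j<M. g (real j / real M) * (V j n x - real n * p j))
          = (\<Sum>j<M. g (real j / real M) * V j n x) - real n * (\<Sum>j<M. g (real j / real M) * p j)"
        by (simp only: sum_distrib_left sum_subtractf right_diff_distrib mult.left_commute)
      moreover have "real n * \<eta> = real n * (\<eta> / 2) + real n * (\<eta> / 2)" by simp
      ultimately show ?thesis unfolding sum_subtractf[of "\<lambda>i. g ((F ^^ i) x)"] by linarith
    qed
    then show "\<exists>c. \<forall>x. \<bar>(\<Sum>i<n. g ((F ^^ i) x)) - real n * c\<bar> \<le> real n * \<eta>" by blast
  qed simp
qed

section \<open>Convergence of Birkhoff averages\<close>

text \<open>If the translation number is \<open>p/q\<close>, the sequence \<open>y\<close> obtained by iterating \<open>F\<^sup>q - p\<close> is monotone,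
  because this map is, and it is bounded by \<open>iter_bounded\<close>. Its limit is the point of a periodic orbit
  to which the orbit of \<open>x\<close> converges.\<close>

lemma rational_case_blocks:
  fixes g :: "real \<Rightarrow> real"
  assumes rat: "translation_number \<in> \<rat>"
    and contg: "continuous_on UNIV g" and per: "\<And>x m. g (x + of_int m) = g x" and \<eta>: "\<eta> > 0"
  shows "\<exists>N K c. N > 0 \<and>
    (\<forall>k\<ge>K. \<bar>(\<Sum>i<N. g ((F ^^ (k * N + i)) x)) - real N * c\<bar> \<le> real N * \<eta>)"
proof -
  obtain p :: int and q :: nat where q: "q > 0" and pq: "translation_number = of_int p / real q"
    using rat by (metis Rats_cases' of_nat_0_less_iff of_int_of_nat_eq zero_less_imp_eq_int)
  define y where "y k = (F ^^ (k * q)) x - real k * of_int p" for k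
  have y_iter: "(F ^^ i) (y k) = (F ^^ (k * q + i)) x - of_int (int k * p)" for i k
  proof -
    have "y k = (F ^^ (k * q)) x + of_int (- (int k * p))" by (simp add: y_def)
    then have "(F ^^ i) (y k) = (F ^^ i) ((F ^^ (k * q)) x) + of_int (- (int k * p))"
      by (simp only: iter_shift_int)
    then show ?thesis by (simp add: funpow_add[of i] add.commute[of _ i])
  qed
  have y_Suc: "y (Suc k) = (F ^^ q) (y k) - of_int p" for k
    unfolding y_iter by (simp add: y_def add.commute algebra_simps)
  have y_mono: "(F ^^ q) s - of_int p \<le> (F ^^ q) t - of_int p" if "s \<le> t" for s t
    using mono_iter[OF that] by simp
  have "monoseq y"
  proof (cases "y 0 \<le> y 1")
    case True
    have "y k \<le> y (Suc k)" for k
    proof (induction k)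
      case (Suc k)
      then show ?case using y_mono y_Suc[of k] y_Suc[of "Suc k"] by metis
    qed (use True in simp)
    then show ?thesis by (auto simp: monoseq_Suc)
  next
    case False
    have "y (Suc k) \<le> y k" for k
    proof (induction k)
      case (Suc k)
      then show ?case using y_mono y_Suc[of k] y_Suc[of "Suc k"] by metis
    qed (use False in simp)
    then show ?thesis by (auto simp: monoseq_Suc)
  qed
  moreover have "Bseq y"
  proof (rule BseqI')
    fix k
    have "real (k * q) * translation_number = real k * of_int p" using q by (simp add: pq)
    then show "norm (y k) \<le> \<bar>x\<bar> + 2"
      using iter_bounded[of "k * q" x] unfolding y_def real_norm_def by linarith
  qed
  ultimately have "convergent y" by (simp add: Bseq_monoseq_convergent)
  then obtain z where z: "y \<longlonglongrightarrow> z" by (auto simp: convergent_def)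
  have "(\<lambda>k. g ((F ^^ (k * q + i)) x)) \<longlonglongrightarrow> g ((F ^^ i) z)" for i
  proof -
    have "isCont g t" for t using contg by (simp add: continuous_on_eq_continuous_at)
    then have "(\<lambda>k. g ((F ^^ i) (y k))) \<longlonglongrightarrow> g ((F ^^ i) z)"
      by (intro isCont_tendsto_compose[of _ g] isCont_tendsto_compose[OF isCont_iter z])
    moreover have "g ((F ^^ i) (y k)) = g ((F ^^ (k * q + i)) x)" for k
      using per[of "(F ^^ i) (y k)" "int k * p"] by (simp add: y_iter)
    ultimately show ?thesis by simp
  qed
  then have "(\<lambda>k. \<Sum>i<q. g ((F ^^ (k * q + i)) x)) \<longlonglongrightarrow> (\<Sum>i<q. g ((F ^^ i) z))"
    by (intro tendsto_sum)
  then have "\<forall>\<^sub>F k in sequentially. dist (\<Sum>i<q. g ((F ^^ (k * q + i)) x)) (\<Sum>i<q. g ((F ^^ i) z)) < real q * \<eta>"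
    by (rule tendstoD) (use q \<eta> in simp)
  then obtain K where "\<And>k. k \<ge> K \<Longrightarrow> \<bar>(\<Sum>i<q. g ((F ^^ (k * q + i)) x)) - (\<Sum>i<q. g ((F ^^ i) z))\<bar> < real q * \<eta>"
    by (auto simp: eventually_sequentially dist_real_def)
  then show ?thesis
    using q by (intro exI[of _ q] exI[of _ K] exI[of _ "(\<Sum>i<q. g ((F ^^ i) z)) / real q"])
      (auto intro: less_imp_le)
qed

text \<open>Whichever the arithmetic nature of the translation number, blocks of a suitable length eventually
  have almost constant averages. In the irrational case \<open>g\<close> is divided by \<open>B'\<close> only to meet the
  normalisation by \<open>1\<close> of the preceding equidistribution theorem.\<close>

theorem birkhoff_averages_convergent:
  fixes g :: "real \<Rightarrow> real"
  assumes contg: "continuous_on UNIV g" and per: "\<And>x m. g (x + of_int m) = g x"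
  shows "convergent (\<lambda>n. (\<Sum>i<n. g ((F ^^ i) x)) / real n)"
proof -
  have "compact (g ` {0..1})"
    using contg by (intro compact_continuous_image) (auto intro: continuous_on_subset)
  then obtain B where B: "\<And>t. t \<in> {0..1} \<Longrightarrow> \<bar>g t\<bar> \<le> B"
    using compact_imp_bounded bounded_iff by (metis imageI real_norm_def)
  have gB: "\<bar>g t\<bar> \<le> B" for t
    using B[of "frac t"] per[of "frac t" "\<lfloor>t\<rfloor>"] frac_lt_1[of t] by (simp add: frac_def)
  define B' where "B' = B + 1"
  have B': "B' > 0" unfolding B'_def using gB[of 0] by linarith
  show ?thesis
  proof (rule averages_convergentI[OF gB])
    fix \<eta> :: real assume \<eta>: "\<eta> > 0"
    show "\<exists>N K c. N > 0 \<and>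
      (\<forall>k\<ge>K. \<bar>(\<Sum>i<N. g ((F ^^ (k * N + i)) x)) - real N * c\<bar> \<le> real N * \<eta>)"
    proof (cases "translation_number \<in> \<rat>")
      case True
      then show ?thesis by (rule rational_case_blocks[OF _ contg per \<eta>])
    next
      case False
      define e where "e = \<eta> / B'"
      have e: "e > 0" using \<eta> B' by (simp add: e_def)
      have "uniformly_continuous_on UNIV (\<lambda>x. g x / B')"
        using B' by (intro periodic_uniformly_continuous continuous_intros contg) (auto simp: per)
      then obtain \<delta> where \<delta>: "\<delta> > 0" "\<And>x y. \<bar>x - y\<bar> < \<delta> \<Longrightarrow> \<bar>g x / B' - g y / B'\<bar> \<le> e / 2"
        unfolding uniformly_continuous_on_def dist_real_def using half_gt_zero[OF e]
        by (metis UNIV_I less_imp_le)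
      obtain N where N: "N > 0" "\<exists>c. \<forall>x. \<bar>(\<Sum>i<N. g ((F ^^ i) x) / B') - real N * c\<bar> \<le> real N * e"
      proof (rule equiuniform_equidistribution[OF False \<delta>(1) e])
        fix N :: nat assume "N > 0" and *: "\<And>n g. n \<ge> N \<Longrightarrow> (\<And>x m. g (x + of_int m) = g x) \<Longrightarrow> (\<And>x. \<bar>g x\<bar> \<le> 1)
          \<Longrightarrow> (\<And>x y. \<bar>x - y\<bar> < \<delta> \<Longrightarrow> \<bar>g x - g y\<bar> \<le> e / 2)
          \<Longrightarrow> \<exists>c. \<forall>x. \<bar>(\<Sum>i<n. g ((F ^^ i) x)) - real n * c\<bar> \<le> real n * e"
        have "\<bar>g t / B'\<bar> \<le> 1" for t
          using gB[of t] B' by (simp add: abs_div_pos[symmetric] B'_def)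
        then show thesis
          by (intro that[of N] *[of N "\<lambda>t. g t / B'"] \<delta>(2) \<open>N > 0\<close>) (simp_all only: per order_refl)
      qed
      then obtain c where c: "\<And>x. \<bar>(\<Sum>i<N. g ((F ^^ i) x) / B') - real N * c\<bar> \<le> real N * e"
        by blast
      have "\<bar>(\<Sum>i<N. g ((F ^^ (k * N + i)) x)) - real N * (c * B')\<bar> \<le> real N * \<eta>" for k
      proof -
        have "\<bar>(\<Sum>i<N. g ((F ^^ (k * N + i)) x) / B') - real N * c\<bar> \<le> real N * e"
          using c[of "(F ^^ (k * N)) x"] by (simp add: funpow_add add.commute)
        then have "\<bar>(\<Sum>i<N. g ((F ^^ (k * N + i)) x) / B') - real N * c\<bar> * B' \<le> real N * e * B'"
          using B' by (intro mult_right_mono) auto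
        moreover have "\<bar>(\<Sum>i<N. g ((F ^^ (k * N + i)) x) / B') - real N * c\<bar> * B'
            = \<bar>(\<Sum>i<N. g ((F ^^ (k * N + i)) x)) - real N * (c * B')\<bar>"
          using B' by (simp add: abs_mult_pos sum_divide_distrib[symmetric] left_diff_distrib mult.assoc)
        ultimately show ?thesis using B' by (simp add: e_def)
      qed
      then show ?thesis using N(1) by blast
    qed
  qed
qed

section \<open>Perturbation of lifts\<close>

lemma displacement_periodic: "displacement F (x + of_int m) = displacement F x"
  by (simp add: displacement_def shift_int)

lemma displacement_continuous: "continuous_on UNIV (displacement F)"
  unfolding displacement_def by (intro continuous_intros cont)

lemma uniformly_continuous: "uniformly_continuous_on UNIV F"
proof -
  have "uniformly_continuous_on UNIV (\<lambda>x. displacement F x + x)"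
    by (intro uniformly_continuous_on_add periodic_uniformly_continuous
        displacement_continuous displacement_periodic uniformly_continuous_on_id)
  then show ?thesis by (simp add: displacement_def)
qed

text \<open>Uniform continuity of \<open>F\<close> propagates closeness of maps to closeness of finitely many iterates.\<close>

lemma iter_stable:
  assumes "\<epsilon> > 0"
  shows "\<exists>\<eta>>0. \<forall>G. (\<forall>x. \<bar>G x - F x\<bar> < \<eta>) \<longrightarrow> (\<forall>i\<le>n. \<forall>x. \<bar>(G ^^ i) x - (F ^^ i) x\<bar> < \<epsilon>)"
  using assms
proof (induction n arbitrary: \<epsilon>)
  case 0
  then show ?case by (intro exI[of _ 1]) simp
next
  case (Suc n)
  obtain \<delta> where \<delta>: "\<delta> > 0" "\<And>x y. \<bar>y - x\<bar> < \<delta> \<Longrightarrow> \<bar>F y - F x\<bar> < \<epsilon> / 2"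
    using uniformly_continuous half_gt_zero[OF Suc.prems]
    unfolding uniformly_continuous_on_def dist_real_def by (metis UNIV_I)
  obtain \<eta> where \<eta>: "\<eta> > 0" "\<And>G i x. (\<And>x. \<bar>G x - F x\<bar> < \<eta>) \<Longrightarrow> i \<le> n \<Longrightarrow>
      \<bar>(G ^^ i) x - (F ^^ i) x\<bar> < min \<delta> \<epsilon>"
    using Suc.IH[of "min \<delta> \<epsilon>"] \<delta>(1) Suc.prems by (metis min_less_iff_conj)
  show ?case
  proof (intro exI[of _ "min \<eta> (\<epsilon> / 2)"] conjI allI impI)
    show "min \<eta> (\<epsilon> / 2) > 0" using \<eta>(1) Suc.prems by simp
    fix G i x assume G: "\<forall>x. \<bar>G x - F x\<bar> < min \<eta> (\<epsilon> / 2)" and "i \<le> Suc n"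
    have IH: "\<bar>(G ^^ i) x - (F ^^ i) x\<bar> < min \<delta> \<epsilon>" if "i \<le> n" for i
      using G that by (intro \<eta>(2)) auto
    show "\<bar>(G ^^ i) x - (F ^^ i) x\<bar> < \<epsilon>"
    proof (cases "i \<le> n")
      case False
      then have i: "i = Suc n" using \<open>i \<le> Suc n\<close> by simp
      have "\<bar>F ((G ^^ n) x) - F ((F ^^ n) x)\<bar> < \<epsilon> / 2"
        using IH[of n] by (intro \<delta>(2)) simp
      moreover have "\<bar>G ((G ^^ n) x) - F ((G ^^ n) x)\<bar> < \<epsilon> / 2" using G by simp
      ultimately have "\<bar>G ((G ^^ n) x) - F ((F ^^ n) x)\<bar> < \<epsilon>" by linarith
      then show ?thesis by (simp add: i)
    qed (use IH in simp)
  qed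
qed

lemma translation_number_eqI:
  assumes "F x = x + of_int k"
  shows "translation_number = of_int k"
proof (rule ccontr)
  assume neq: "translation_number \<noteq> of_int k"
  have it: "(F ^^ n) x = x + real n * of_int k" for n
  proof (induction n)
    case (Suc n)
    have "F (x + of_int (int n * k)) = x + of_int k + of_int (int n * k)"
      unfolding shift_int assms by simp
    then show ?case using Suc by (simp add: algebra_simps)
  qed simp
  have gap: "\<bar>of_int k - translation_number\<bar> > 0" using neq by simp
  then obtain n :: nat where "2 / \<bar>of_int k - translation_number\<bar> < real n"
    using reals_Archimedean2 by blast
  then have "2 < real n * \<bar>of_int k - translation_number\<bar>"
    using gap by (simp add: pos_divide_less_eq)
  also have "\<dots> = \<bar>real n * of_int k - real n * translation_number\<bar>"
    by (simp add: abs_mult right_diff_distrib[symmetric])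
  also have "\<dots> \<le> 2" using iter_bounded[of n x] unfolding it by simp
  finally show False by simp
qed

text \<open>A displacement that takes an integer value \<open>k\<close> would force the translation number to be \<open>k\<close>. So it
  stays between two consecutive integers, and by periodicity keeps a positive distance from them.
  This room keeps the displacement of nearby maps inside \<open>[0,1]\<close>.\<close>

lemma displacement_bounds:
  assumes "translation_number \<notin> \<rat>" "F 0 \<in> {0<..<1}"
  obtains \<eta> where "\<eta> > 0" "\<And>x. displacement F x \<in> {\<eta>..1 - \<eta>}"
proof -
  have not_int: "displacement F x \<noteq> of_int k" for x k
    using translation_number_eqI[of x k] assms(1) by (auto simp: displacement_def)
  have range: "displacement F x \<in> {0<..<1}" for x
  proof -
    have conn: "is_interval (range (displacement F))"
      using displacement_continuous connected_continuous_image is_interval_connected_1 connected_UNIV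
      by blast
    have 0: "displacement F 0 \<in> {0<..<1}" using assms(2) by (simp add: displacement_def)
    have "0 \<notin> range (displacement F)" "1 \<notin> range (displacement F)"
      using not_int[of _ 0] not_int[of _ 1] by fastforce+
    then show ?thesis
      using conn 0 unfolding is_interval_1
      by (metis greaterThanLessThan_iff linorder_not_less order_less_imp_le rangeI)
  qed
  define f where "f x = min (displacement F x) (1 - displacement F x)" for x
  have "continuous_on {0..1} f"
    unfolding f_def using displacement_continuous
    by (intro continuous_intros) (auto intro: continuous_on_subset)
  then obtain x0 where x0: "\<forall>x\<in>{0..1}. f x0 \<le> f x"
    using continuous_attains_inf[of "{0..1::real}" f] by auto
  have f: "f x0 \<le> f x" for x
  proof -
    have "f x = f (frac x)"
      using displacement_periodic[of "frac x" "\<lfloor>x\<rfloor>"] by (simp add: f_def frac_def)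
    then show ?thesis using x0 frac_lt_1[of x] by simp
  qed
  show ?thesis
  proof (rule that[of "f x0"])
    show "f x0 > 0" using range[of x0] by (simp add: f_def)
    show "displacement F x \<in> {f x0..1 - f x0}" for x using f[of x] by (simp add: f_def)
  qed
qed

end

section \<open>Lifts of circle homeomorphisms\<close>

lemma circle_cover_cis: "circle_cover x = cis (2 * pi * x)"
  by (simp add: circle_cover_def cis_conv_exp mult_ac)

lemma circle_cover_in_S1: "circle_cover x \<in> S1"
  by (simp add: circle_cover_cis)

lemma dist_circle_cover: "dist (circle_cover x) (circle_cover y) = 2 * \<bar>sin (pi * (x - y))\<bar>"
proof -
  have "(dist (circle_cover x) (circle_cover y))\<^sup>2 = 2 - 2 * cos (2 * (pi * (x - y)))"
  proof -
    have "(dist (circle_cover x) (circle_cover y))\<^sup>2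
        = (cos (2 * pi * x) - cos (2 * pi * y))\<^sup>2 + (sin (2 * pi * x) - sin (2 * pi * y))\<^sup>2"
      by (simp add: dist_norm circle_cover_cis cmod_power2)
    also have "\<dots> = ((sin (2 * pi * x))\<^sup>2 + (cos (2 * pi * x))\<^sup>2) + ((sin (2 * pi * y))\<^sup>2 + (cos (2 * pi * y))\<^sup>2)
        - 2 * (cos (2 * pi * x) * cos (2 * pi * y) + sin (2 * pi * x) * sin (2 * pi * y))"
      by (simp only: power2_eq_square) (simp add: algebra_simps)
    also have "\<dots> = 2 - 2 * cos (2 * pi * x - 2 * pi * y)"
      by (simp add: cos_diff)
    also have "2 * pi * x - 2 * pi * y = 2 * (pi * (x - y))" by (simp add: algebra_simps)
    finally show ?thesis .
  qed
  also have "\<dots> = (2 * \<bar>sin (pi * (x - y))\<bar>)\<^sup>2"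
    by (simp add: cos_double_sin power_mult_distrib)
  finally show ?thesis by (rule power2_eq_imp_eq) simp_all
qed

lemma circle_cover_eq_iff: "circle_cover x = circle_cover y \<longleftrightarrow> x - y \<in> \<int>"
proof -
  have "circle_cover x = circle_cover y \<longleftrightarrow> sin (pi * (x - y)) = 0"
    by (metis dist_circle_cover dist_eq_0_iff mult_eq_0_iff abs_eq_0 zero_neq_numeral)
  also have "\<dots> \<longleftrightarrow> x - y \<in> \<int>"
    by (auto simp: sin_zero_iff_int2 mult.commute[of pi] elim!: Ints_cases)
  finally show ?thesis .
qed

lemma circle_cover_shift [simp]: "circle_cover (x + of_int m) = circle_cover x"
  by (simp add: circle_cover_eq_iff)

text \<open>Chordal distance on the circle controls distance modulo the integers, the nearest integer being
  the witness.\<close>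

lemma close_mod_1:
  assumes "dist (circle_cover x) (circle_cover y) < 2 * sin (pi * \<eta>)" "0 < \<eta>" "\<eta> \<le> 1 / 2"
  obtains k :: int where "\<bar>x - y - of_int k\<bar> < \<eta>"
proof
  define e where "e = x - y - of_int (round (x - y))"
  have e: "\<bar>e\<bar> \<le> 1 / 2" using of_int_round_abs_le[of "x - y"] by (simp add: e_def abs_minus_commute)
  have "circle_cover (x - y) = circle_cover e" by (simp add: e_def circle_cover_eq_iff)
  then have "\<bar>sin (pi * (x - y))\<bar> = \<bar>sin (pi * e)\<bar>"
    using dist_circle_cover[of "x - y" 0] dist_circle_cover[of e 0] by simp
  also have "\<dots> = \<bar>sin (pi * \<bar>e\<bar>)\<bar>" by (simp add: abs_if)
  also have "\<dots> = sin (pi * \<bar>e\<bar>)"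
    using mult_left_mono[of "\<bar>e\<bar>" 1 pi] e by (intro abs_of_nonneg sin_ge_zero) auto
  finally have "sin (pi * \<bar>e\<bar>) < sin (pi * \<eta>)" using assms(1) dist_circle_cover[of x y] by simp
  moreover have "- (pi / 2) \<le> pi * \<bar>e\<bar>" by (rule order_trans[of _ 0]) auto
  moreover have "pi * \<bar>e\<bar> \<le> pi / 2" using mult_left_mono[OF e, of pi] by simp
  moreover have "- (pi / 2) \<le> pi * \<eta>" using assms(2) by (smt (verit) mult_nonneg_nonneg pi_gt_zero divide_nonneg_nonneg)
  moreover have "pi * \<eta> \<le> pi / 2" using mult_left_mono[OF assms(3), of pi] by simp
  ultimately have "pi * \<bar>e\<bar> < pi * \<eta>" by (simp only: sin_mono_less_eq)
  then show "\<bar>x - y - of_int (round (x - y))\<bar> < \<eta>" by (simp add: e_def)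
qed

lemma continuous_Ints_constant:
  fixes f :: "real \<Rightarrow> real"
  assumes "continuous_on UNIV f" "\<And>x. f x \<in> \<int>"
  obtains k :: int where "\<And>x. f x = of_int k"
proof -
  have "f constant_on UNIV"
  proof (rule continuous_discrete_range_constant[OF connected_UNIV assms(1)])
    fix x :: real
    have "1 \<le> \<bar>f y - f x\<bar>" if "f y \<noteq> f x" for y
      using that assms(2)[of x] assms(2)[of y] Ints_nonzero_abs_ge1[of "f y - f x"] by auto
    then show "\<exists>e>0. \<forall>y. y \<in> UNIV \<and> f y \<noteq> f x \<longrightarrow> e \<le> norm (f y - f x)"
      by (intro exI[of _ 1]) auto
  qed
  then obtain c where "\<And>x. f x = c" by (auto simp: constant_on_def)
  then show ?thesis using assms(2)[of 0] by (metis Ints_cases that)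
qed

lemma lifts_differ_by_int:
  assumes "is_lift \<Phi> \<phi>" "is_lift \<Phi>' \<phi>"
  obtains k :: int where "\<And>x. \<Phi> x = \<Phi>' x + of_int k"
proof -
  have "\<Phi> x - \<Phi>' x \<in> \<int>" for x
    using assms by (simp add: is_lift_def flip: circle_cover_eq_iff)
  moreover have "continuous_on UNIV (\<lambda>x. \<Phi> x - \<Phi>' x)"
    using assms by (auto simp: is_lift_def intro: continuous_on_diff)
  ultimately obtain k :: int where "\<And>x. \<Phi> x - \<Phi>' x = of_int k"
    using continuous_Ints_constant[of "\<lambda>x. \<Phi> x - \<Phi>' x"] by blast
  then show ?thesis using that[of k] by (simp add: diff_eq_eq add.commute)
qed

lemma circle_lift_of_homeo:
  assumes homeo: "orientation_preserving_homeo \<phi>" and lift: "is_lift \<Phi> \<phi>"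
  shows "circle_lift \<Phi>"
proof
  show cont: "continuous_on UNIV \<Phi>" using lift by (simp add: is_lift_def)
  obtain \<Phi>0 where "is_lift \<Phi>0 \<phi>" "strict_mono \<Phi>0"
    using homeo by (auto simp: orientation_preserving_homeo_def)
  then show mono: "strict_mono \<Phi>"
    using lifts_differ_by_int[OF lift] by (metis add_less_cancel_right strict_mono_def)
  have per: "is_lift (\<lambda>x. \<Phi> (x + 1)) \<phi>"
    using lift circle_cover_shift[of _ 1]
    by (auto simp: is_lift_def intro!: continuous_on_compose2[OF cont] continuous_intros)
  obtain d :: int where d: "\<And>x. \<Phi> (x + 1) = \<Phi> x + of_int d"
    using lifts_differ_by_int[OF per lift] by blast
  have "\<Phi> 0 < \<Phi> 1" using mono by (simp add: strict_mono_def)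
  then have "d \<ge> 1" using d[of 0] by simp
  \<comment> \<open>A degree larger than one would give \<open>\<phi>\<close> the same value at \<open>0\<close> and at some \<open>t\<close> inside \<open>(0,1)\<close>.\<close>
  moreover have "\<not> d \<ge> 2"
  proof
    assume "d \<ge> 2"
    then have "\<Phi> 0 + 1 < \<Phi> 1" using d[of 0] by simp
    then obtain t where t: "0 \<le> t" "t \<le> 1" "\<Phi> t = \<Phi> 0 + 1"
      using IVT'[of \<Phi> 0 "\<Phi> 0 + 1" 1] cont by (auto intro: continuous_on_subset)
    have "t \<noteq> 0" "t \<noteq> 1" using t(3) \<open>\<Phi> 0 + 1 < \<Phi> 1\<close> by auto
    have "\<phi> (circle_cover t) = \<phi> (circle_cover 0)"
      using lift circle_cover_shift[of "\<Phi> 0" 1] t(3) unfolding is_lift_def by (metis of_int_1)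
    moreover have "inj_on \<phi> S1"
      using homeo by (auto simp: orientation_preserving_homeo_def homeomorphism_def intro: inj_on_inverseI)
    ultimately have "circle_cover t = circle_cover 0"
      by (metis inj_onD circle_cover_in_S1)
    then have "t \<in> \<int>" by (simp add: circle_cover_eq_iff)
    then show False
      using t \<open>t \<noteq> 0\<close> \<open>t \<noteq> 1\<close> by (auto elim!: Ints_cases)
  qed
  ultimately show "\<Phi> (x + 1) = \<Phi> x + 1" for x using d[of x] by simp
qed

text \<open>The rotation number is defined from an unspecified lift. Its translation number differs from that
  of \<open>\<Phi>\<close> by an integer.\<close>

lemma translation_number_irrational:
  assumes homeo: "orientation_preserving_homeo \<phi>" and lift: "is_lift \<Phi> \<phi>"
    and irr: "rotation_number \<phi> \<notin> \<rat>"
  shows "circle_lift.translation_number \<Phi> \<notin> \<rat>"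
proof
  define \<Phi>0 where "\<Phi>0 = (SOME \<Phi>. is_lift \<Phi> \<phi>)"
  have lift0: "is_lift \<Phi>0 \<phi>" unfolding \<Phi>0_def by (rule someI[of _ \<Phi>]) (rule lift)
  interpret F: circle_lift \<Phi> by (rule circle_lift_of_homeo[OF homeo lift])
  interpret F0: circle_lift \<Phi>0 by (rule circle_lift_of_homeo[OF homeo lift0])
  obtain k :: int where k: "\<And>x. \<Phi>0 x = \<Phi> x + of_int k"
    using lifts_differ_by_int[OF lift0 lift] by blast
  have it: "(\<Phi>0 ^^ n) x = (\<Phi> ^^ n) x + of_int (int n * k)" for n x
  proof (induction n)
    case (Suc n)
    have "(\<Phi>0 ^^ Suc n) x = \<Phi> ((\<Phi> ^^ n) x + of_int (int n * k)) + of_int k"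
      by (simp only: funpow.simps o_apply Suc k)
    also have "\<dots> = (\<Phi> ^^ Suc n) x + of_int (int (Suc n) * k)"
      unfolding F.shift_int by (simp add: algebra_simps)
    finally show ?case .
  qed simp
  have "(\<lambda>n. (\<Phi> ^^ n) 0 / real n + of_int k) \<longlonglongrightarrow> F.translation_number + of_int k"
    by (intro tendsto_intros F.translation_number_LIMSEQ)
  moreover have "\<forall>\<^sub>F n in sequentially. (\<Phi> ^^ n) 0 / real n + of_int k = (\<Phi>0 ^^ n) 0 / real n"
    using eventually_gt_at_top[of 0] by eventually_elim (simp add: it field_simps)
  ultimately have "(\<lambda>n. (\<Phi>0 ^^ n) 0 / real n) \<longlonglongrightarrow> F.translation_number + of_int k"
    by (rule Lim_transform_eventually)
  then have "F0.translation_number = F.translation_number + of_int k"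
    using LIMSEQ_unique F0.translation_number_LIMSEQ by blast
  moreover assume "F.translation_number \<in> \<rat>"
  ultimately have "F0.translation_number \<in> \<rat>" by simp
  then have "frac F0.translation_number \<in> \<rat>" by (simp add: frac_def)
  then show False
    using irr unfolding rotation_number_def F0.translation_number_def \<Phi>0_def[symmetric] by simp
qed

text \<open>Closeness on the circle yields closeness of the lifts modulo an integer at each point. The
  normalisation at \<open>0\<close> makes this integer zero there, and it cannot jump: by continuity the
  difference of the lifts would have to take the modulus \<open>\<eta>\<close>, which is too far from every integer.\<close>

lemma lifts_uniformly_close:
  fixes \<Phi> \<Phi>' :: "real \<Rightarrow> real"
  assumes cont: "continuous_on UNIV \<Phi>" "continuous_on UNIV \<Phi>'"
    and close: "\<And>x. dist (circle_cover (\<Phi> x)) (circle_cover (\<Phi>' x)) < 2 * sin (pi * \<eta>)"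
    and \<eta>: "0 < \<eta>" "\<eta> \<le> 1 / 4"
    and base: "\<Phi> 0 \<in> {\<eta>..1 - \<eta>}" "\<Phi>' 0 \<in> {0..<1}"
  shows "\<bar>\<Phi>' x - \<Phi> x\<bar> < \<eta>"
proof -
  define D where "D x = \<Phi> x - \<Phi>' x" for x
  have near: "\<exists>k::int. \<bar>D x - of_int k\<bar> < \<eta>" for x
    unfolding D_def using close_mod_1[OF close[of x] \<eta>(1)] \<eta>(2) by force
  have 0: "\<bar>D 0\<bar> < \<eta>"
  proof -
    obtain k :: int where k: "\<bar>D 0 - of_int k\<bar> < \<eta>" using near by blast
    have "of_int k < (1 :: real)" "of_int k > (-1 :: real)"
      using k base unfolding D_def by (auto simp: abs_less_iff)
    then have "k = 0" by linarith
    then show ?thesis using k by simp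
  qed
  have "\<bar>D x\<bar> < \<eta>"
  proof (rule ccontr)
    assume far: "\<not> \<bar>D x\<bar> < \<eta>"
    have "is_interval (range (\<lambda>x. \<bar>D x\<bar>))"
      unfolding D_def is_interval_connected_1
      by (intro connected_continuous_image continuous_intros cont connected_UNIV)
    then have "\<eta> \<in> range (\<lambda>x. \<bar>D x\<bar>)"
      using 0 far unfolding is_interval_1 by (metis linorder_not_less order_less_imp_le rangeI)
    then obtain y where y: "\<bar>D y\<bar> = \<eta>" by auto
    obtain k :: int where k: "\<bar>D y - of_int k\<bar> < \<eta>" using near by blast
    have "\<bar>of_int k\<bar> < (1 :: real)" using y k \<eta>(2) by linarith
    then have "k = 0" by linarith
    then show False using y k by simp
  qed
  then show ?thesis by (simp add: D_def abs_minus_commute)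
qed

lemma homeo_in_C0_S1:
  assumes "orientation_preserving_homeo \<phi>"
  shows "\<phi> \<in> C0_S1"
  using assms by (auto simp: orientation_preserving_homeo_def C0_S1_def homeomorphism_def PiE_def)

section \<open>Weak limits of empirical measures\<close>

lemma empirical_measure_eq_distr:
  assumes "n > 0"
  shows "empirical_measure y n = distr (uniform_count_measure {..<n}) borel y"
proof (rule measure_eqI)
  fix A :: "real set" assume "A \<in> sets (empirical_measure y n)"
  then have A: "A \<in> sets borel" by simp
  have "emeasure (empirical_measure y n) A = ennreal (1 / real n) * (\<Sum>i<n. indicator A (y i))"
    by (rule emeasure_empirical_measure[OF A])
  also have "(\<Sum>i<n. indicator A (y i) :: ennreal) = of_nat (card (y -` A \<inter> {..<n}))"
    by (simp add: indicator_def of_bool_def sum.If_cases vimage_def Int_commute)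
  also have "ennreal (1 / real n) * of_nat (card (y -` A \<inter> {..<n}))
      = ennreal (real (card (y -` A \<inter> {..<n})) / real n)"
    by (simp add: ennreal_of_nat_eq_real_of_nat ennreal_mult[symmetric])
  also have "\<dots> = emeasure (distr (uniform_count_measure {..<n}) borel y) A"
    by (subst emeasure_distr)
      (auto simp: A emeasure_uniform_count_measure space_uniform_count_measure measurable_def
        sets_uniform_count_measure)
  finally show "emeasure (empirical_measure y n) A
      = emeasure (distr (uniform_count_measure {..<n}) borel y) A" .
qed simp

lemma measurable_uniform_count_measure:
  "f \<in> borel_measurable (uniform_count_measure A)" if "f ` A \<subseteq> space borel"
  using that by (auto simp: measurable_def space_uniform_count_measure sets_uniform_count_measure)

lemma real_distribution_empirical_measure:
  assumes "n > 0"
  shows "real_distribution (empirical_measure y n)"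
proof -
  interpret prob_space "uniform_count_measure {..<n}"
    using assms by (intro prob_space_uniform_count_measure) auto
  show ?thesis
    unfolding empirical_measure_eq_distr[OF assms]
    by (intro real_distribution_distr measurable_uniform_count_measure) simp
qed

lemma integral_empirical_measure:
  fixes f :: "real \<Rightarrow> real"
  assumes "n > 0" "f \<in> borel_measurable borel"
  shows "integral\<^sup>L (empirical_measure y n) f = (\<Sum>i<n. f (y i)) / real n"
  unfolding empirical_measure_eq_distr[OF assms(1)]
  by (subst integral_distr)
    (use assms in \<open>simp_all add: measurable_uniform_count_measure integral_uniform_count_measure\<close>)

text \<open>Tightness provides a limit along a subsequence. Since the averages of every continuous function
  converge along the full sequence, that limit does not depend on the subsequence. The index is
  shifted by one because the empirical measure of no points is the zero measure.\<close>

lemma empirical_measures_weak_limit: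
  fixes y :: "nat \<Rightarrow> real"
  assumes y: "\<And>i. y i \<in> {0..1}"
    and conv: "\<And>f. continuous_on UNIV f \<Longrightarrow> convergent (\<lambda>n. (\<Sum>i<n. f (y i)) / real n)"
  obtains \<nu> where "real_distribution \<nu>" "emeasure \<nu> {0..1} = 1" "weak_conv_m (empirical_measure y) \<nu>"
    "\<And>f B. continuous_on UNIV f \<Longrightarrow> (\<And>x. \<bar>f x\<bar> \<le> B) \<Longrightarrow>
      (\<lambda>n. (\<Sum>i<n. f (y i)) / real n) \<longlonglongrightarrow> integral\<^sup>L \<nu> f"
proof -
  define \<mu> where "\<mu> n = empirical_measure y (Suc n)" for n
  have \<mu>: "real_distribution (\<mu> n)" for n
    unfolding \<mu>_def by (rule real_distribution_empirical_measure) simp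
  have int: "integral\<^sup>L (\<mu> n) f = (\<Sum>i<Suc n. f (y i)) / real (Suc n)"
    if "continuous_on UNIV f" for f :: "real \<Rightarrow> real" and n
    unfolding \<mu>_def using that
    by (intro integral_empirical_measure borel_measurable_continuous_onI) simp_all
  have "tight \<mu>"
    unfolding tight_def
  proof (intro conjI allI impI \<mu>)
    have "emeasure (\<mu> n) {-1<..1} = 1" for n
    proof -
      have "indicator {-1<..1} (y i) = (1::ennreal)" for i using y[of i] by (auto simp: indicator_def)
      then have "emeasure (\<mu> n) {-1<..1} = ennreal (1 / real (Suc n)) * of_nat (Suc n)"
        unfolding \<mu>_def by (subst emeasure_empirical_measure) auto
      also have "\<dots> = 1"
        by (simp add: ennreal_of_nat_eq_real_of_nat ennreal_mult[symmetric] del: of_nat_Suc)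
      finally show ?thesis .
    qed
    then have "measure (\<mu> n) {-1<..1} = 1" for n by (simp add: measure_def)
    then show "\<exists>a b. a < b \<and> (\<forall>n. 1 - e < measure (\<mu> n) {a<..b})" if "0 < e" for e
      using that by (intro exI[of _ "-1"] exI[of _ 1]) simp
  qed
  then obtain r \<nu> where r: "strict_mono r" and \<nu>: "real_distribution \<nu>"
    and "weak_conv_m (\<mu> \<circ> id \<circ> r) \<nu>"
    using tight_imp_convergent_subsubsequence[of \<mu> id] strict_mono_id by blast
  then have sub: "weak_conv_m (\<lambda>n. \<mu> (r n)) \<nu>" by (simp add: o_def)
  interpret \<nu>: real_distribution \<nu> by (rule \<nu>)
  have lim: "(\<lambda>n. (\<Sum>i<n. f (y i)) / real n) \<longlonglongrightarrow> integral\<^sup>L \<nu> f"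
    if f: "continuous_on UNIV f" "\<And>x. \<bar>f x\<bar> \<le> B" for f B
  proof -
    obtain L where L: "(\<lambda>n. (\<Sum>i<n. f (y i)) / real n) \<longlonglongrightarrow> L"
      using conv[OF f(1)] by (auto simp: convergent_def)
    then have "(\<lambda>n. integral\<^sup>L (\<mu> n) f) \<longlonglongrightarrow> L"
      unfolding int[OF f(1)] by (rule LIMSEQ_Suc)
    then have "(\<lambda>n. integral\<^sup>L (\<mu> (r n)) f) \<longlonglongrightarrow> L"
      using LIMSEQ_subseq_LIMSEQ[OF _ r] by (simp add: o_def)
    moreover have "(\<lambda>n. integral\<^sup>L (\<mu> (r n)) f) \<longlonglongrightarrow> integral\<^sup>L \<nu> f"
      using f by (intro weak_conv_imp_integral_bdd_continuous_conv[OF \<mu> \<nu> sub])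
        (auto simp: continuous_on_eq_continuous_at)
    ultimately show ?thesis using L LIMSEQ_unique by blast
  qed
  show ?thesis
  proof (rule that[OF \<nu> _ _ lim])
    have "weak_conv_m \<mu> \<nu>"
    proof (rule integral_bdd_continuous_conv_imp_weak_conv[OF \<mu> \<nu>])
      fix f :: "real \<Rightarrow> real" assume "\<And>x. isCont f x" "\<And>x. \<bar>f x\<bar> \<le> 1"
      then have f: "continuous_on UNIV f" "\<And>x. \<bar>f x\<bar> \<le> 1"
        by (simp_all add: continuous_on_eq_continuous_at)
      show "(\<lambda>n. integral\<^sup>L (\<mu> n) f) \<longlonglongrightarrow> integral\<^sup>L \<nu> f"
        unfolding int[OF f(1)] by (rule LIMSEQ_Suc[OF lim[OF f]])
    qed
    then show "weak_conv_m (empirical_measure y) \<nu>"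
      unfolding weak_conv_m_def weak_conv_def \<mu>_def by (auto intro: LIMSEQ_imp_Suc)
  next
    \<comment> \<open>A bounded continuous function that vanishes exactly on \<open>[0,1]\<close> detects the mass outside.\<close>
    define f where "f x = min 1 (infdist x {0..1::real})" for x
    have f: "continuous_on UNIV f" "\<bar>f x\<bar> \<le> 1" "0 \<le> f x" for x
      unfolding f_def by (auto intro!: continuous_intros simp: infdist_nonneg)
    have [measurable]: "f \<in> borel_measurable borel" by (rule borel_measurable_continuous_onI[OF f(1)])
    have "f (y i) = 0" for i using y[of i] by (simp add: f_def)
    then have "integral\<^sup>L \<nu> f = 0"
      using lim[OF f(1,2)] by (simp add: LIMSEQ_const_iff)
    moreover have int_f: "integrable \<nu> f"
      using f by (intro \<nu>.integrable_const_bound[of _ 1]) auto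
    ultimately have "AE x in \<nu>. f x = 0"
      using integral_nonneg_eq_0_iff_AE[OF int_f] f(3) by simp
    moreover have "x \<in> {0..1}" if "f x = 0" for x
      using that in_closed_iff_infdist_zero[of "{0..1::real}" x] by (auto simp: f_def min_def split: if_splits)
    ultimately have "AE x in \<nu>. x \<in> {0..1}" by auto
    then show "emeasure \<nu> {0..1} = 1" by (intro \<nu>.emeasure_eq_1_AE) auto
  qed
qed

section \<open>The Fortet-Mourier distance on the unit interval\<close>

text \<open>Precomposing with the retraction onto \<open>[0,1]\<close> extends a 1-Lipschitz function on the interval to the
  line, and subtracting its value at \<open>0\<close>, which does not affect differences of integrals against
  probability measures, bounds it by \<open>1\<close>.\<close>

lemma fortet_mourier_unit_interval_le:
  fixes M N :: "real measure"
  assumes M: "real_distribution M" "emeasure M {0..1} = 1"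
    and N: "real_distribution N" "emeasure N {0..1} = 1"
    and le: "\<And>f. 1-lipschitz_on UNIV f \<Longrightarrow> (\<And>x. \<bar>f x\<bar> \<le> 1) \<Longrightarrow>
      \<bar>integral\<^sup>L M f - integral\<^sup>L N f\<bar> \<le> c"
  shows "fortet_mourier {0..1} M N \<le> c"
  unfolding fortet_mourier_def
proof (rule cSUP_least)
  have "1-lipschitz_on {0..1} (\<lambda>x::real. 0::real)" by (simp add: lipschitz_on_def)
  then show "{f :: real \<Rightarrow> real. 1-lipschitz_on {0..1} f} \<noteq> {}" by blast
next
  fix f :: "real \<Rightarrow> real" assume "f \<in> {f. 1-lipschitz_on {0..1} f}"
  then have f: "1-lipschitz_on {0..1} f" by simp
  define g where "g x = f (max 0 (min 1 x)) - f 0" for x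
  have lip: "\<bar>g x - g y\<bar> \<le> \<bar>max 0 (min 1 x) - max 0 (min 1 y)\<bar>" for x y
    using lipschitz_onD[OF f, of "max 0 (min 1 x)" "max 0 (min 1 y)"] by (simp add: g_def dist_real_def)
  have g_lip: "1-lipschitz_on UNIV g"
  proof (rule lipschitz_onI)
    show "dist (g x) (g y) \<le> 1 * dist x y" for x y
      using lip[of x y] unfolding dist_real_def by (auto simp: max_def min_def split: if_splits)
  qed simp
  have g_bdd: "\<bar>g x\<bar> \<le> 1" for x
    using lip[of x 0] by (simp add: g_def)
  have "(LINT x:{0..1}|P. f x) = integral\<^sup>L P g + f 0"
    if "real_distribution P" "emeasure P {0..1} = 1" for P
  proof -
    interpret P: real_distribution P by (rule that(1))
    have cont: "continuous_on UNIV g" "continuous_on {0..1} f"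
      using g_lip f lipschitz_on_continuous_on by blast+
    have [measurable]: "g \<in> borel_measurable borel"
      "(\<lambda>x. indicator {0..1} x *\<^sub>R f x) \<in> borel_measurable borel"
      by (intro borel_measurable_continuous_onI borel_measurable_continuous_on_indicator cont; simp)+
    have "AE x in P. x \<in> {0..1}"
      using that(2) by (intro P.AE_prob_1) (simp add: measure_def)
    then have "AE x in P. indicator {0..1} x *\<^sub>R f x = g x + f 0"
      by eventually_elim (auto simp: g_def)
    then have "(LINT x:{0..1}|P. f x) = (LINT x|P. g x + f 0)"
      unfolding set_lebesgue_integral_def
      by (intro integral_cong_AE) measurable
    moreover have "integrable P g"
      using g_bdd by (intro P.integrable_const_bound[of _ 1]) auto
    ultimately show ?thesis using P.prob_space by simp
  qed
  then show "\<bar>(LINT x:{0..1}|M. f x) - (LINT x:{0..1}|N. f x)\<bar> \<le> c"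
    using le[OF g_lip g_bdd] M N by simp
qed

section \<open>The displacement distribution\<close>

lemma integral_displacement_distribution:
  fixes f :: "real \<Rightarrow> real"
  assumes "sets \<mu> = sets (restrict_space borel S1)"
    and "\<Psi> \<in> borel_measurable borel" "f \<in> borel_measurable borel"
  shows "integral\<^sup>L (displacement_distribution \<Psi> \<mu>) f = (LINT z|\<mu>. f (\<Psi> (inv_into {0..<1} circle_cover z)))"
proof -
  have inv: "inv_into {0..<1} circle_cover \<in> measurable \<mu> (restrict_space borel {0..<1})"
    using measurable_inv_circle_cover assms(1) measurable_cong_sets by blast
  have "integral\<^sup>L (displacement_distribution \<Psi> \<mu>) f = integral\<^sup>L (on_unit_interval \<mu>) (\<lambda>x. f (\<Psi> x))"
    unfolding displacement_distribution_def
    by (rule integral_distr) (use assms in \<open>simp_all add: on_unit_interval_def measurable_restrict_space1\<close>)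
  also have "\<dots> = (LINT z|\<mu>. f (\<Psi> (inv_into {0..<1} circle_cover z)))"
    unfolding on_unit_interval_def
    by (rule integral_distr[OF inv]) (use assms in \<open>simp add: measurable_restrict_space1\<close>)
  finally show ?thesis .
qed

lemma displacement_distribution_unit_interval:
  assumes "prob_space \<mu>" "sets \<mu> = sets (restrict_space borel S1)"
    and \<Psi>: "\<Psi> \<in> borel_measurable borel" "\<And>x. \<Psi> x \<in> {0..1}"
  shows "real_distribution (displacement_distribution \<Psi> \<mu>)"
    and "emeasure (displacement_distribution \<Psi> \<mu>) {0..1} = 1"
proof -
  interpret \<mu>: prob_space \<mu> by fact
  have inv: "inv_into {0..<1} circle_cover \<in> measurable \<mu> (restrict_space borel {0..<1})"
    using measurable_inv_circle_cover assms(2) measurable_cong_sets by blast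
  interpret I: prob_space "on_unit_interval \<mu>"
    unfolding on_unit_interval_def by (rule \<mu>.prob_space_distr[OF inv])
  have meas: "\<Psi> \<in> borel_measurable (on_unit_interval \<mu>)"
    using \<Psi>(1) by (simp add: on_unit_interval_def measurable_restrict_space1)
  show "real_distribution (displacement_distribution \<Psi> \<mu>)"
    unfolding displacement_distribution_def by (rule I.real_distribution_distr[OF meas])
  have "\<Psi> -` {0..1} \<inter> space (on_unit_interval \<mu>) = space (on_unit_interval \<mu>)"
    using \<Psi>(2) by auto
  then show "emeasure (displacement_distribution \<Psi> \<mu>) {0..1} = 1"
    unfolding displacement_distribution_def by (simp add: emeasure_distr[OF meas] I.emeasure_space_1)
qed

lemma inv_circle_cover_lift:
  obtains k :: int where "inv_into {0..<1} circle_cover (circle_cover x) = x + of_int k"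
proof -
  have "circle_cover x \<in> circle_cover ` {0..<1}"
    using circle_cover_shift[of "frac x" "\<lfloor>x\<rfloor>"] frac_lt_1[of x]
    by (intro image_eqI[of _ _ "frac x"]) (auto simp: frac_def)
  then have "circle_cover (inv_into {0..<1} circle_cover (circle_cover x)) = circle_cover x"
    by (rule f_inv_into_f)
  then obtain k where "inv_into {0..<1} circle_cover (circle_cover x) - x = of_int k"
    by (auto simp: circle_cover_eq_iff elim: Ints_cases)
  then show ?thesis by (intro that[of k]) simp
qed

lemma integral_invariant_iterate:
  fixes G :: "complex \<Rightarrow> real"
  assumes inv: "invariant_prob \<phi> \<mu>" and \<phi>: "\<phi> \<in> C0_S1" and G: "G \<in> borel_measurable \<mu>"
  shows "(\<lambda>z. G ((\<phi> ^^ i) z)) \<in> borel_measurable \<mu>"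
    and "(LINT z|\<mu>. G ((\<phi> ^^ i) z)) = integral\<^sup>L \<mu> G"
proof -
  have sets: "sets \<mu> = sets (restrict_space borel S1)"
    using inv by (simp add: invariant_prob_def)
  have "\<phi> \<in> measurable (restrict_space borel S1) (restrict_space borel S1)"
    using \<phi> by (intro measurable_restrict_space2 borel_measurable_continuous_on_restrict)
      (auto simp: C0_S1_def space_restrict_space)
  then have meas: "\<phi> \<in> measurable \<mu> \<mu>"
    using sets measurable_cong_sets by blast
  have distr: "distr \<mu> \<mu> \<phi> = \<mu>"
    using inv by (intro measure_eqI) (simp_all add: emeasure_distr[OF meas] invariant_prob_def)
  have "(\<lambda>z. G ((\<phi> ^^ i) z)) \<in> borel_measurable \<mu> \<and> (LINT z|\<mu>. G ((\<phi> ^^ i) z)) = integral\<^sup>L \<mu> G"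
  proof (induction i)
    case (Suc i)
    have eq: "(\<lambda>z. G ((\<phi> ^^ Suc i) z)) = (\<lambda>z. G ((\<phi> ^^ i) (\<phi> z)))"
      by (simp add: funpow_swap1)
    have "(LINT z|\<mu>. G ((\<phi> ^^ i) (\<phi> z))) = (LINT z|distr \<mu> \<mu> \<phi>. G ((\<phi> ^^ i) z))"
      using Suc by (intro integral_distr[OF meas, symmetric]) simp
    then show ?case
      unfolding eq using Suc measurable_compose[OF meas, of "\<lambda>z. G ((\<phi> ^^ i) z)" borel]
      by (simp add: distr)
  qed (simp add: G)
  then show "(\<lambda>z. G ((\<phi> ^^ i) z)) \<in> borel_measurable \<mu>"
    and "(LINT z|\<mu>. G ((\<phi> ^^ i) z)) = integral\<^sup>L \<mu> G" by simp_all
qed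

text \<open>By invariance, the integral of an observable equals the integral of its block averages, and these
  all lie within \<open>\<eta>\<close> of \<open>c\<close>.\<close>

lemma displacement_distribution_near_block_average:
  fixes f :: "real \<Rightarrow> real"
  assumes homeo: "orientation_preserving_homeo \<phi>" and lift: "is_lift \<Phi> \<phi>"
    and inv: "invariant_prob \<phi> \<mu>"
    and f: "continuous_on UNIV f" "\<And>x. \<bar>f x\<bar> \<le> B"
    and N: "N > 0"
    and blocks: "\<And>x. \<bar>(\<Sum>i<N. f (displacement \<Phi> ((\<Phi> ^^ i) x))) - real N * c\<bar> \<le> real N * \<eta>"
  shows "\<bar>integral\<^sup>L (displacement_distribution (displacement \<Phi>) \<mu>) f - c\<bar> \<le> \<eta>"
proof -
  interpret F: circle_lift \<Phi> by (rule circle_lift_of_homeo[OF homeo lift])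
  have sets: "sets \<mu> = sets (restrict_space borel S1)" and prob: "prob_space \<mu>"
    using inv by (simp_all add: invariant_prob_def)
  interpret \<mu>: prob_space \<mu> by (rule prob)
  have space: "space \<mu> = S1" using sets_eq_imp_space_eq[OF sets] by (simp add: space_restrict_space)
  have meas: "displacement \<Phi> \<in> borel_measurable borel" "f \<in> borel_measurable borel"
    by (intro borel_measurable_continuous_onI F.displacement_continuous f(1))+
  define G where "G z = f (displacement \<Phi> (inv_into {0..<1} circle_cover z))" for z
  have "inv_into {0..<1} circle_cover \<in> measurable \<mu> (restrict_space borel {0..<1})"
    using measurable_inv_circle_cover sets measurable_cong_sets by blast
  then have "inv_into {0..<1} circle_cover \<in> borel_measurable \<mu>"
    by (simp add: measurable_restrict_space2_iff)
  then have G: "G \<in> borel_measurable \<mu>"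
    unfolding G_def using meas by measurable
  note iter = integral_invariant_iterate[OF inv homeo_in_C0_S1[OF homeo] G]
  have G_iter: "integrable \<mu> (\<lambda>z. G ((\<phi> ^^ i) z))" for i
    using iter(1) f(2) by (intro \<mu>.integrable_const_bound[of _ B]) (auto simp: G_def)
  have G_cover: "G (circle_cover x) = f (displacement \<Phi> x)" for x
    using inv_circle_cover_lift[of x] by (metis G_def F.displacement_periodic)
  have \<phi>_iter: "(\<phi> ^^ i) (circle_cover x) = circle_cover ((\<Phi> ^^ i) x)" for i x
    using lift by (induction i) (auto simp: is_lift_def)
  have block: "\<bar>(\<Sum>i<N. G ((\<phi> ^^ i) z)) - real N * c\<bar> \<le> real N * \<eta>" if "z \<in> space \<mu>" for z
  proof -
    have "z = circle_cover (Arg2pi z / (2 * pi))"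
      using that Arg2pi_eq[of z] by (auto simp: circle_cover_def space mult_ac)
    then obtain x where "z = circle_cover x" by blast
    then show ?thesis using blocks[of x] by (simp add: \<phi>_iter G_cover)
  qed
  have int_sum: "integrable \<mu> (\<lambda>z. \<Sum>i<N. G ((\<phi> ^^ i) z))"
    by (intro Bochner_Integration.integrable_sum G_iter)
  have sum: "(LINT z|\<mu>. (\<Sum>i<N. G ((\<phi> ^^ i) z))) = real N * integral\<^sup>L \<mu> G"
    by (simp add: Bochner_Integration.integral_sum G_iter iter(2))
  have "real N * c - real N * \<eta> \<le> real N * integral\<^sup>L \<mu> G"
    unfolding sum[symmetric]
    by (rule \<mu>.integral_ge_const[OF int_sum]) (rule AE_I2, use block in \<open>fastforce simp: abs_le_iff\<close>)
  moreover have "real N * integral\<^sup>L \<mu> G \<le> real N * c + real N * \<eta>"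
    unfolding sum[symmetric]
    by (rule \<mu>.integral_le_const[OF int_sum]) (rule AE_I2, use block in \<open>fastforce simp: abs_le_iff\<close>)
  ultimately have "real N * (c - \<eta>) \<le> real N * integral\<^sup>L \<mu> G" "real N * integral\<^sup>L \<mu> G \<le> real N * (c + \<eta>)"
    by (simp_all add: algebra_simps)
  then have "c - \<eta> \<le> integral\<^sup>L \<mu> G" "integral\<^sup>L \<mu> G \<le> c + \<eta>"
    using N by simp_all
  moreover have "integral\<^sup>L (displacement_distribution (displacement \<Phi>) \<mu>) f = integral\<^sup>L \<mu> G"
    unfolding G_def by (rule integral_displacement_distribution[OF sets meas])
  ultimately show ?thesis by (simp add: abs_le_iff)
qed

theorem theorem3p15:
  fixes \<phi> :: "complex \<Rightarrow> complex" and \<Phi> :: "real \<Rightarrow> real" and \<mu> :: "complex measure"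
    and \<epsilon> :: real
  assumes "orientation_preserving_homeo \<phi>"
    and "rotation_number \<phi> \<notin> \<rat>"
    and "is_lift \<Phi> \<phi>" and "\<Phi> 0 \<in> {0<..<1}"
    and "invariant_prob \<phi> \<mu>"
    and "\<epsilon> > 0"
  shows "\<exists>U. openin C0_topology U \<and> \<phi> \<in> U \<and>
    (\<forall>\<phi>' \<in> U. orientation_preserving_homeo \<phi>' \<longrightarrow>
      (\<forall>\<Phi>'. is_lift \<Phi>' \<phi>' \<and> \<Phi>' 0 \<in> {0..<1} \<longrightarrow>
        (\<forall>x\<^sub>0 \<in> {0..1}. \<exists>\<nu>.
          real_distribution \<nu> \<and> emeasure \<nu> {0..1} = 1 \<and>
          weak_conv_m (empirical_measure (\<lambda>i. displacement \<Phi>' ((\<Phi>' ^^ i) x\<^sub>0))) \<nu> \<and>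
          fortet_mourier {0..1} \<nu> (displacement_distribution (displacement \<Phi>) \<mu>) < \<epsilon>)))"
proof -
  note homeo = assms(1) and lift = assms(3) and inv = assms(5)
  interpret F: circle_lift \<Phi> by (rule circle_lift_of_homeo[OF homeo lift])
  have irr: "F.translation_number \<notin> \<rat>"
    by (rule translation_number_irrational[OF homeo lift assms(2)])
  obtain \<eta>1 where \<eta>1: "\<eta>1 > 0" "\<And>x. displacement \<Phi> x \<in> {\<eta>1..1 - \<eta>1}"
    using F.displacement_bounds[OF irr assms(4)] by blast
  \<comment> \<open>The error is \<open>e\<close> for the blocks of \<open>\<phi>\<close>, \<open>2 * e\<close> for passing to \<open>\<phi>'\<close> (both ends of a
    displacement move), \<open>e\<close> for passing from blocks to the limit, and \<open>e\<close> for the integral against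
    the displacement distribution: five in all, strictly less than six.\<close>
  define e where "e = \<epsilon> / 6"
  have e: "e > 0" using assms(6) by (simp add: e_def)
  have "uniformly_continuous_on UNIV (displacement \<Phi>)"
    by (intro periodic_uniformly_continuous F.displacement_continuous F.displacement_periodic)
  then obtain \<delta> where \<delta>: "\<delta> > 0" "\<And>x y. \<bar>x - y\<bar> < \<delta> \<Longrightarrow> \<bar>displacement \<Phi> x - displacement \<Phi> y\<bar> \<le> e / 2"
    unfolding uniformly_continuous_on_def dist_real_def using half_gt_zero[OF e]
    by (metis UNIV_I less_imp_le)
  obtain N where N: "N > 0" and N_blocks: "\<And>f. 1-lipschitz_on UNIV f \<Longrightarrow> (\<And>x. \<bar>f x\<bar> \<le> 1) \<Longrightarrow>
      \<exists>c. \<forall>x. \<bar>(\<Sum>i<N. f (displacement \<Phi> ((\<Phi> ^^ i) x))) - real N * c\<bar> \<le> real N * e"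
  proof (rule F.equiuniform_equidistribution[OF irr \<delta>(1) e])
    fix N :: nat assume "N > 0" and *: "\<And>n g. n \<ge> N \<Longrightarrow> (\<And>x m. g (x + of_int m) = g x) \<Longrightarrow> (\<And>x. \<bar>g x\<bar> \<le> 1)
      \<Longrightarrow> (\<And>x y. \<bar>x - y\<bar> < \<delta> \<Longrightarrow> \<bar>g x - g y\<bar> \<le> e / 2)
      \<Longrightarrow> \<exists>c. \<forall>x. \<bar>(\<Sum>i<n. g ((\<Phi> ^^ i) x)) - real n * c\<bar> \<le> real n * e"
    show thesis
    proof (rule that[OF \<open>N > 0\<close>])
      fix f :: "real \<Rightarrow> real" assume f: "1-lipschitz_on UNIV f" "\<And>x. \<bar>f x\<bar> \<le> 1"
      show "\<exists>c. \<forall>x. \<bar>(\<Sum>i<N. f (displacement \<Phi> ((\<Phi> ^^ i) x))) - real N * c\<bar> \<le> real N * e"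
      proof (rule *[of N "\<lambda>x. f (displacement \<Phi> x)"])
        fix x y :: real assume "\<bar>x - y\<bar> < \<delta>"
        then show "\<bar>f (displacement \<Phi> x) - f (displacement \<Phi> y)\<bar> \<le> e / 2"
          using lipschitz_onD[OF f(1), of "displacement \<Phi> x" "displacement \<Phi> y"] \<delta>(2)[of x y]
          by (simp add: dist_real_def)
      qed (simp_all add: F.displacement_periodic f(2))
    qed
  qed
  obtain \<eta>2 where \<eta>2: "\<eta>2 > 0" "\<And>G i x. (\<And>x. \<bar>G x - \<Phi> x\<bar> < \<eta>2) \<Longrightarrow> i \<le> N \<Longrightarrow> \<bar>(G ^^ i) x - (\<Phi> ^^ i) x\<bar> < e"
    using F.iter_stable[OF e, of N] by metis
  \<comment> \<open>\<open>\<eta>1\<close> keeps the new displacement in \<open>[0,1]\<close>, \<open>\<eta>2\<close> controls the first \<open>N\<close> iterates, and \<open>1 / 4\<close>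
    lets the chordal distance determine the lift.\<close>
  define \<eta> where "\<eta> = min \<eta>1 (min \<eta>2 (1 / 4))"
  have \<eta>: "0 < \<eta>" "\<eta> \<le> 1 / 4" "\<eta> \<le> \<eta>1" "\<eta> \<le> \<eta>2" using \<eta>1(1) \<eta>2(1) by (simp_all add: \<eta>_def)
  have r: "0 < 2 * sin (pi * \<eta>)" using \<eta> by (intro mult_pos_pos sin_gt_zero) auto
  interpret C0: Metric_space C0_S1 uniform_dist by (rule Metric_space_C0_S1)
  have \<phi>: "\<phi> \<in> C0_S1" by (rule homeo_in_C0_S1[OF homeo])
  show ?thesis
  proof (intro exI[of _ "C0.mball \<phi> (2 * sin (pi * \<eta>))"] conjI ballI impI allI)
    show "openin C0_topology (C0.mball \<phi> (2 * sin (pi * \<eta>)))" by (rule C0.openin_mball)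
    show "\<phi> \<in> C0.mball \<phi> (2 * sin (pi * \<eta>))" using \<phi> r by simp
  next
    fix \<phi>' \<Phi>' and x0 :: real
    assume ball: "\<phi>' \<in> C0.mball \<phi> (2 * sin (pi * \<eta>))" and homeo': "orientation_preserving_homeo \<phi>'"
      and "is_lift \<Phi>' \<phi>' \<and> \<Phi>' 0 \<in> {0..<1}"
    then have lift': "is_lift \<Phi>' \<phi>'" and base': "\<Phi>' 0 \<in> {0..<1}" by simp_all
    interpret G: circle_lift \<Phi>' by (rule circle_lift_of_homeo[OF homeo' lift'])
    have dist: "dist (circle_cover (\<Phi> x)) (circle_cover (\<Phi>' x)) < 2 * sin (pi * \<eta>)" for x
    proof -
      have "dist (\<phi> (circle_cover x)) (\<phi>' (circle_cover x)) \<le> uniform_dist \<phi> \<phi>'"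
        using ball by (intro dist_le_uniform_dist circle_cover_in_S1) auto
      then show ?thesis using ball lift lift' by (auto simp: is_lift_def)
    qed
    have close: "\<bar>\<Phi>' x - \<Phi> x\<bar> < \<eta>" for x
      using \<eta>1(2)[of 0] \<eta>
      by (intro lifts_uniformly_close[OF F.cont G.cont dist \<eta>(1,2) _ base']) (auto simp: displacement_def)
    have disp': "displacement \<Phi>' x \<in> {0..1}" for x
      using close[of x] \<eta>1(2)[of x] \<eta>(3) by (auto simp: displacement_def)
    have iter_close: "\<bar>(\<Phi>' ^^ i) x - (\<Phi> ^^ i) x\<bar> < e" if "i \<le> N" for i x
      using close \<eta>(4) that by (intro \<eta>2(2)) (auto intro: less_le_trans)
    define y where "y i = displacement \<Phi>' ((\<Phi>' ^^ i) x0)" for i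
    obtain \<nu> where \<nu>: "real_distribution \<nu>" "emeasure \<nu> {0..1} = 1" "weak_conv_m (empirical_measure y) \<nu>"
      and lim: "\<And>f B. continuous_on UNIV f \<Longrightarrow> (\<And>x. \<bar>f x\<bar> \<le> B) \<Longrightarrow>
        (\<lambda>n. (\<Sum>i<n. f (y i)) / real n) \<longlonglongrightarrow> integral\<^sup>L \<nu> f"
    proof (rule empirical_measures_weak_limit[of y])
      show "y i \<in> {0..1}" for i unfolding y_def by (rule disp')
      fix f :: "real \<Rightarrow> real" assume f: "continuous_on UNIV f"
      show "convergent (\<lambda>n. (\<Sum>i<n. f (y i)) / real n)"
        unfolding y_def
        by (rule G.birkhoff_averages_convergent)
          (auto simp: G.displacement_periodic intro: continuous_on_compose2[OF f G.displacement_continuous])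
    qed blast
    have "fortet_mourier {0..1} \<nu> (displacement_distribution (displacement \<Phi>) \<mu>) \<le> 5 * e"
    proof (rule fortet_mourier_unit_interval_le[OF \<nu>(1,2)])
      have meas: "displacement \<Phi> \<in> borel_measurable borel"
        by (intro borel_measurable_continuous_onI F.displacement_continuous)
      have range: "displacement \<Phi> x \<in> {0..1}" for x using \<eta>1(1) \<eta>1(2)[of x] by auto
      show "real_distribution (displacement_distribution (displacement \<Phi>) \<mu>)"
        "emeasure (displacement_distribution (displacement \<Phi>) \<mu>) {0..1} = 1"
        using inv by (intro displacement_distribution_unit_interval meas range; simp add: invariant_prob_def)+
      fix f :: "real \<Rightarrow> real" assume f: "1-lipschitz_on UNIV f" "\<And>x. \<bar>f x\<bar> \<le> 1"
      have cont: "continuous_on UNIV f" using f(1) by (rule lipschitz_on_continuous_on)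
      obtain c where c: "\<And>x. \<bar>(\<Sum>i<N. f (displacement \<Phi> ((\<Phi> ^^ i) x))) - real N * c\<bar> \<le> real N * e"
        using N_blocks[OF f] by blast
      have "\<bar>(\<Sum>i<N. f (y (k * N + i))) - real N * c\<bar> \<le> real N * (3 * e)" for k
      proof -
        define z where "z = (\<Phi>' ^^ (k * N)) x0"
        have y: "y (k * N + i) = displacement \<Phi>' ((\<Phi>' ^^ i) z)" for i
          by (simp add: y_def z_def add.commute[of _ i] funpow_add)
        have "\<bar>f (y (k * N + i)) - f (displacement \<Phi> ((\<Phi> ^^ i) z))\<bar> \<le> 2 * e" if "i < N" for i
        proof -
          have "\<bar>f (y (k * N + i)) - f (displacement \<Phi> ((\<Phi> ^^ i) z))\<bar>
              \<le> \<bar>displacement \<Phi>' ((\<Phi>' ^^ i) z) - displacement \<Phi> ((\<Phi> ^^ i) z)\<bar>"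
            using lipschitz_onD[OF f(1)] unfolding y dist_real_def by simp
          also have "\<dots> \<le> 2 * e"
            using iter_close[of i z] iter_close[of "Suc i" z] that by (simp add: displacement_def)
          finally show ?thesis .
        qed
        then have "\<bar>\<Sum>i<N. f (y (k * N + i)) - f (displacement \<Phi> ((\<Phi> ^^ i) z))\<bar> \<le> real N * (2 * e)"
          using sum_norm_bound[of "{..<N}" "\<lambda>i. f (y (k * N + i)) - f (displacement \<Phi> ((\<Phi> ^^ i) z))" "2 * e"]
          by simp
        then show ?thesis using c[of z] by (simp add: sum_subtractf)
      qed
      then have "\<forall>\<^sub>F n in sequentially. \<bar>(\<Sum>i<n. f (y i)) / real n - c\<bar> \<le> 4 * e"
        using e by (intro block_averages[of "\<lambda>i. f (y i)" 1 N 0 c "3 * e"] f(2) N) auto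
      moreover have "(\<lambda>n. \<bar>(\<Sum>i<n. f (y i)) / real n - c\<bar>) \<longlonglongrightarrow> \<bar>integral\<^sup>L \<nu> f - c\<bar>"
        by (intro tendsto_intros lim[OF cont f(2)])
      ultimately have "\<bar>integral\<^sup>L \<nu> f - c\<bar> \<le> 4 * e"
        by (intro tendsto_upperbound) auto
      moreover have "\<bar>integral\<^sup>L (displacement_distribution (displacement \<Phi>) \<mu>) f - c\<bar> \<le> e"
        by (rule displacement_distribution_near_block_average[OF homeo lift inv cont f(2) N c])
      ultimately show "\<bar>integral\<^sup>L \<nu> f - integral\<^sup>L (displacement_distribution (displacement \<Phi>) \<mu>) f\<bar> \<le> 5 * e"
        by linarith
    qed
    also have "5 * e < \<epsilon>" using assms(6) by (simp add: e_def)
    finally show "\<exists>\<nu>. real_distribution \<nu> \<and> emeasure \<nu> {0..1} = 1 \<and>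
          weak_conv_m (empirical_measure (\<lambda>i. displacement \<Phi>' ((\<Phi>' ^^ i) x0))) \<nu> \<and>
          fortet_mourier {0..1} \<nu> (displacement_distribution (displacement \<Phi>) \<mu>) < \<epsilon>"
      using \<nu> unfolding y_def by blast
  qed
qed

end
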